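(* Let $A_\rho = \sum_{n=0}^\infty \rho(S_n)$ (a convergent series). Then $\rho(S_n) \sim A_\rho/n^2$ as $n\to\infty$; that is, $n^2\rho(S_n)\to A_\rho$ as $n\to\infty$.
   Context: $S_n$ is the symmetric group of degree $n$, with $S_0$ the trivial group, so that $\rho(S_0)=1$. $\rho(S_n)$ denotes the probability that, if $\sigma,\tau\in S_n$ are chosen independently and uniformly at random, then $\sigma$ and $\tau$ have conjugates (in $S_n$) that commute; equivalently, $\sigma$ commutes with some conjugate of $\tau$. *)

theory Defs
  imports
    "HOL-Probability.Probability"
    "HOL-Algebra.Sym_Groups"
    "HOL-Library.Landau_Symbols"
begin

definition conjugates :: "('a, 'b) monoid_scheme \<Rightarrow> 'a \<Rightarrow> 'a set" where
  "conjugates G x = {g \<otimes>\<^bsub>G\<^esub> x \<otimes>\<^bsub>G\<^esub> inv\<^bsub>G\<^esub> g | g. g \<in> carrier G}"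

definition have_commuting_conjugates :: "('a, 'b) monoid_scheme \<Rightarrow> 'a \<Rightarrow> 'a \<Rightarrow> bool" where
  "have_commuting_conjugates G x y \<longleftrightarrow>
     (\<exists>x' \<in> conjugates G x. \<exists>y' \<in> conjugates G y. x' \<otimes>\<^bsub>G\<^esub> y' = y' \<otimes>\<^bsub>G\<^esub> x')"

text \<open>Meaningful only for a group with finite carrier; \<open>pair_pmf\<close> is the independent product.\<close>

definition rho :: "('a, 'b) monoid_scheme \<Rightarrow> real" where
  "rho G = measure_pmf.prob (pair_pmf (pmf_of_set (carrier G)) (pmf_of_set (carrier G)))
             {(x, y). have_commuting_conjugates G x y}"

definition A_rho :: real where
  "A_rho = (\<Sum>n. rho (sym_group n))"

end

theory Submission
  imports Defs "HOL-Combinatorics.Orbits" "HOL-Library.Discrete_Functions"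
    "HOL-Real_Asymp.Real_Asymp"
begin

text \<open>
Write \<open>\<rho>\<^sub>n\<close> for the probability in question. Whether two permutations have commuting
conjugates depends only on their cycle types, and the proportion of permutations of degree \<open>n\<close>
with \<open>m\<^sub>i\<close> cycles of length \<open>i\<close> is the product over \<open>i\<close> of \<open>1 / (i ^ m\<^sub>i * m\<^sub>i!)\<close>. So \<open>\<rho>\<^sub>n\<close> is a
weighted count of the pairs of partitions of \<open>n\<close> that occur as the types of two commuting
permutations (\<open>rho_sym_group\<close>). Two inequalities, both obtained by deleting an orbit of the
commuting pair, carry the proof.

Lower bound (\<open>commuting_weight_lower\<close>). If both permutations have a cycle of length \<open>k > n/2\<close>, that
cycle is unique, the event has probability \<open>1/k\<^sup>2\<close>, and it suffices that what remains of
the two permutations, a uniformly distributed pair of degree \<open>n - k\<close>, has commuting conjugates.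
Hence \<open>\<rho>\<^sub>n\<close> is at least the sum of \<open>\<rho>\<^sub>n\<^sub>-\<^sub>k / k\<^sup>2\<close> over \<open>n/2 < k \<le> n\<close>.

Upper bound (\<open>commuting_weight_upper\<close>). If \<open>p\<close> and \<open>q\<close> commute, then \<open>q\<close> maps cycles of \<open>p\<close> to cycles
of \<open>p\<close> of the same length. On an orbit of the group generated by \<open>p\<close> and \<open>q\<close> all cycles of \<open>p\<close> thus
have one length, and so do all cycles of \<open>q\<close>. Deleting an orbit of size \<open>m\<close> therefore removes from
both types a partition of \<open>m\<close> into equal parts, and such partitions have total weight at most
\<open>1/m + 8/m\<^sup>2\<close>, the main term coming from a single cycle of length \<open>m\<close>. An orbit of size \<open>m > r\<close>
exists as soon as one of the permutations has a cycle longer than \<open>r\<close>; a single random permutation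
fails this with probability at most \<open>1 / (n div r)!\<close>. Hence, for every \<open>r > 0\<close>, \<open>\<rho>\<^sub>n\<close> is at most
\<open>(1 / (n div r)!)\<^sup>2\<close> plus the sum of \<open>(1/m + 8/m\<^sup>2)\<^sup>2 * \<rho>\<^sub>n\<^sub>-\<^sub>m\<close> over \<open>r < m \<le> n\<close>.

The rest is analysis. Take \<open>r\<close> to be the integer part of the square root of \<open>n\<close> and multiply the
upper bound by \<open>n\<^sup>2\<close>. The factorial term tends to \<open>0\<close>. If \<open>j\<^sup>2 \<rho>\<^sub>j \<le> C\<close> for all \<open>j < n\<close>, the terms with
\<open>m \<le> n/2\<close> contribute at most \<open>324 * C / r\<close>. The terms with \<open>m = n - j > n/2\<close> are at most
\<open>324 * \<rho>\<^sub>j\<close> and, for fixed \<open>j\<close>, tend to \<open>\<rho>\<^sub>j\<close>. An induction on \<open>n\<close> then shows that \<open>n\<^sup>2 \<rho>\<^sub>n\<close> is bounded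
(\<open>quadratic_bound\<close>), so the series converges, and Tannery's theorem shows that the upper bound for
\<open>n\<^sup>2 \<rho>\<^sub>n\<close> tends to the sum of the series. The lower bound is at least the partial sum over
\<open>j < n/2\<close>, which tends to the same limit.
\<close>

section \<open>Cycle types of permutations of a finite set\<close>

text \<open>Unlike \<open>permutes\<close>, this leaves \<open>p\<close> unconstrained outside \<open>A\<close>, so that a permutation can be restricted
to a union of its cycles without changing the function.\<close>
definition perm_on :: "'a set \<Rightarrow> ('a \<Rightarrow> 'a) \<Rightarrow> bool" where
  "perm_on A p \<longleftrightarrow> finite A \<and> p ` A = A"

definition cycle_type :: "'a set \<Rightarrow> ('a \<Rightarrow> 'a) \<Rightarrow> nat multiset" where
  "cycle_type A p = image_mset card (mset_set (orbit p ` A))"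

lemma perm_onI:
  assumes "finite A" "\<And>x. x \<in> A \<Longrightarrow> p x \<in> A" "inj_on p A"
  shows "perm_on A p"
  unfolding perm_on_def
  by (intro conjI assms(1) endo_inj_surj[OF assms(1) image_subsetI assms(3)] assms(2))

lemma perm_on_finite: "perm_on A p \<Longrightarrow> finite A"
  by (simp add: perm_on_def)

lemma perm_on_in: "perm_on A p \<Longrightarrow> x \<in> A \<Longrightarrow> p x \<in> A"
  unfolding perm_on_def by blast

lemma perm_on_inj: "perm_on A p \<Longrightarrow> inj_on p A"
  by (simp add: perm_on_def eq_card_imp_inj_on)

lemma perm_on_bij: "perm_on A p \<Longrightarrow> bij_betw p A A"
  unfolding bij_betw_def by (auto intro: perm_on_inj simp: perm_on_def)

lemma permutes_perm_on: "finite A \<Longrightarrow> p permutes A \<Longrightarrow> perm_on A p"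
  by (simp add: perm_on_def permutes_image)

lemma perm_on_comp: "perm_on A p \<Longrightarrow> perm_on A q \<Longrightarrow> perm_on A (p \<circ> q)"
  unfolding perm_on_def by (simp only: image_comp[symmetric])

lemma perm_on_funpow: "perm_on A p \<Longrightarrow> perm_on A (p ^^ n)"
proof (induction n)
  case 0
  then show ?case by (simp add: perm_on_def)
next
  case (Suc n)
  then show ?case unfolding funpow.simps by (intro perm_on_comp)
qed

lemma perm_on_cong:
  assumes "perm_on A p" "\<And>x. x \<in> A \<Longrightarrow> p x = q x"
  shows "perm_on A q"
proof -
  have "q ` A = p ` A" using assms(2) by (intro image_cong refl) (rule sym)
  then show ?thesis using assms(1) by (simp add: perm_on_def)
qed

lemma perm_on_subset:
  assumes "perm_on A p" "B \<subseteq> A" "\<And>x. x \<in> B \<Longrightarrow> p x \<in> B"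
  shows "perm_on B p"
  by (rule perm_onI[OF finite_subset[OF assms(2) perm_on_finite[OF assms(1)]] assms(3)
        inj_on_subset[OF perm_on_inj[OF assms(1)] assms(2)]])

lemma perm_on_Diff:
  assumes "perm_on A p" "perm_on B p" "B \<subseteq> A"
  shows "perm_on (A - B) p"
proof -
  have "p ` (A - B) = p ` A - p ` B"
    by (rule inj_on_image_set_diff[OF perm_on_inj[OF assms(1)] Diff_subset assms(3)])
  then show ?thesis using assms(1,2) by (simp add: perm_on_def)
qed

lemma orbit_subset_perm_on:
  assumes "perm_on A p" "x \<in> A" shows "orbit p x \<subseteq> A"
proof
  fix y assume "y \<in> orbit p x"
  then show "y \<in> A" by induct (auto simp: perm_on_in assms)
qed

text \<open>The set \<open>orbit p x\<close> consists of the forward iterates of \<open>p x\<close>. It is finite and \<open>p\<close> maps it into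
itself injectively, hence onto itself; the preimage of \<open>p x\<close> in it can only be \<open>x\<close>.\<close>
lemma perm_on_self_in_orbit:
  assumes "perm_on A p" "x \<in> A" shows "x \<in> orbit p x"
proof -
  let ?O = "orbit p x"
  note sub = orbit_subset_perm_on[OF assms]
  have "finite ?O"
    by (rule finite_subset[OF sub perm_on_finite[OF assms(1)]])
  moreover have "inj_on p ?O"
    by (rule inj_on_subset[OF perm_on_inj[OF assms(1)] sub])
  moreover have "p ` ?O \<subseteq> ?O"
    by (auto intro: orbit.step)
  ultimately have "p ` ?O = ?O"
    by (intro endo_inj_surj)
  then have "p x \<in> p ` ?O"
    by (simp only: orbit.base)
  then obtain y where y: "y \<in> ?O" "p x = p y"
    by (rule imageE)
  have "x = y"
    by (rule inj_onD[OF perm_on_inj[OF assms(1)] y(2) assms(2) subsetD[OF sub y(1)]])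
  show ?thesis by (subst (1) \<open>x = y\<close>) (rule y(1))
qed

lemma orbit_eq_perm_on:
  assumes "perm_on A p" "x \<in> A" "y \<in> orbit p x" shows "orbit p y = orbit p x"
proof (intro equalityI subsetI)
  show "z \<in> orbit p x" if "z \<in> orbit p y" for z
    by (rule orbit_trans[OF that assms(3)])
  show "z \<in> orbit p y" if "z \<in> orbit p x" for z
    by (rule orbit_trans[OF that orbit_swap[OF perm_on_self_in_orbit[OF assms(1,2)] assms(3)]])
qed

lemma perm_on_orbit:
  assumes "perm_on A p" "x \<in> A" shows "perm_on (orbit p x) p"
  by (rule perm_on_subset[OF assms(1) orbit_subset_perm_on[OF assms]]) (rule orbit.step)

lemma orbit_conv_image: "orbit f y = (\<lambda>n. (f ^^ n) y) ` {0<..}"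
  unfolding orbit_altdef by (auto simp: image_iff)

lemma orbit_conj:
  assumes p: "perm_on A p" and x: "x \<in> A" and h: "\<And>z. z \<in> A \<Longrightarrow> h (p z) = q (h z)"
  shows "orbit q (h x) = h ` orbit p x"
proof -
  have *: "h ((p ^^ n) x) = (q ^^ n) (h x)" for n
  proof (induction n)
    case (Suc n)
    have "h ((p ^^ Suc n) x) = q (h ((p ^^ n) x))"
      unfolding funpow.simps o_apply by (rule h[OF perm_on_in[OF perm_on_funpow[OF p] x]])
    then show ?case by (simp only: Suc.IH funpow.simps o_apply)
  qed simp
  show ?thesis
    by (simp add: orbit_conv_image image_image *)
qed

lemma cycle_type_conj:
  assumes p: "perm_on A p" and h: "inj_on h A" and c: "\<And>x. x \<in> A \<Longrightarrow> h (p x) = q (h x)"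
  shows "cycle_type (h ` A) q = cycle_type A p"
proof -
  have "orbit q (h x) = h ` orbit p x" if "x \<in> A" for x
    by (rule orbit_conj[OF p that]) (rule c)
  then have eq: "orbit q ` h ` A = (`) h ` orbit p ` A"
    unfolding image_image by (rule image_cong[OF refl])
  have sub: "X \<subseteq> A" if "X \<in> orbit p ` A" for X using that orbit_subset_perm_on[OF p] by auto
  have inj: "inj_on ((`) h) (orbit p ` A)"
    by (rule inj_onI) (simp only: inj_on_image_eq_iff[OF h sub sub])
  have "cycle_type (h ` A) q = image_mset card (image_mset ((`) h) (mset_set (orbit p ` A)))"
    unfolding cycle_type_def eq image_mset_mset_set[OF inj] ..
  also have "\<dots> = image_mset card (mset_set (orbit p ` A))"
    unfolding multiset.map_comp
  proof (rule image_mset_cong)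
    fix X assume "X \<in># mset_set (orbit p ` A)"
    then have "X \<in> orbit p ` A"
      using perm_on_finite[OF p] by simp
    then show "(card \<circ> (`) h) X = card X"
      unfolding o_apply by (rule card_image[OF inj_on_subset[OF h sub]])
  qed
  finally show ?thesis by (simp add: cycle_type_def)
qed

lemma cycle_type_cong:
  assumes p: "perm_on A p" and c: "\<And>x. x \<in> A \<Longrightarrow> p x = q x"
  shows "cycle_type A p = cycle_type A q"
proof -
  have "cycle_type (id ` A) q = cycle_type A p"
    by (rule cycle_type_conj[OF p]) (simp_all add: c)
  then show ?thesis by simp
qed

lemma cycle_type_Un:
  assumes "perm_on A p" "perm_on B p" "A \<inter> B = {}"
  shows "cycle_type (A \<union> B) p = cycle_type A p + cycle_type B p"
proof -
  have "orbit p ` A \<inter> orbit p ` B = {}"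
  proof (rule ccontr)
    assume "orbit p ` A \<inter> orbit p ` B \<noteq> {}"
    then obtain x y where xy: "x \<in> A" "y \<in> B" "orbit p x = orbit p y" by auto
    then have "x \<in> B"
      using perm_on_self_in_orbit[OF assms(1) xy(1)] orbit_subset_perm_on[OF assms(2) xy(2)] by auto
    then show False using assms(3) xy(1) by auto
  qed
  then show ?thesis
    using assms by (simp add: cycle_type_def image_Un mset_set_Union perm_on_finite)
qed

lemma cycle_type_Diff:
  assumes "perm_on A p" "perm_on B p" "B \<subseteq> A"
  shows "cycle_type A p = cycle_type B p + cycle_type (A - B) p"
  using cycle_type_Un[OF assms(2) perm_on_Diff[OF assms]] assms(3) by (simp add: Un_absorb1)

lemma cycle_type_orbit:
  assumes "perm_on A p" "x \<in> A"
  shows "cycle_type (orbit p x) p = {#card (orbit p x)#}"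
proof -
  have "orbit p ` orbit p x = {orbit p x}"
    using orbit_eq_perm_on[OF assms] orbit_nonempty[of p x] by auto
  then show ?thesis by (simp add: cycle_type_def)
qed

lemma in_cycle_type_iff: "finite A \<Longrightarrow> k \<in># cycle_type A p \<longleftrightarrow> (\<exists>x\<in>A. k = card (orbit p x))"
  by (auto simp: cycle_type_def)

lemma cycle_type_empty [simp]: "cycle_type {} p = {#}"
  by (simp add: cycle_type_def)

text \<open>Structural induction on a permutation: it arises from the empty one by adding cycles.\<close>
lemma perm_on_induct [consumes 1, case_names empty orbit]:
  assumes "perm_on A p" "P {}"
    and "\<And>A x. perm_on A p \<Longrightarrow> x \<in> A \<Longrightarrow> P (A - orbit p x) \<Longrightarrow> P A"
  shows "P A"
  using assms(1)
proof (induction "card A" arbitrary: A rule: less_induct)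
  case less
  show ?case
  proof (cases "A = {}")
    case False
    then obtain x where x: "x \<in> A" by auto
    then have "card (A - orbit p x) < card A"
      using perm_on_finite[OF less.prems] perm_on_self_in_orbit[OF less.prems x]
      by (intro psubset_card_mono) auto
    then show ?thesis
      using less.hyps perm_on_Diff[OF less.prems perm_on_orbit[OF less.prems x]]
        orbit_subset_perm_on[OF less.prems x] assms(3)[OF less.prems x] by blast
  qed (simp add: assms)
qed

text \<open>A cycle of length \<open>k\<close> is seen from each of its \<open>k\<close> points.\<close>
lemma sum_cycle_type_weighted:
  assumes "perm_on A p"
  shows "(\<Sum>x\<in>A. f (card (orbit p x))) = (\<Sum>k\<in>#cycle_type A p. of_nat k * (f k :: 'b :: comm_semiring_1))"
  using assms
proof (induction rule: perm_on_induct)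
  case (orbit A x)
  note o = perm_on_orbit[OF orbit(1,2)]  orbit_subset_perm_on[OF orbit(1,2)]
  have "(\<Sum>x\<in>A. f (card (orbit p x)))
     = (\<Sum>y\<in>A - orbit p x. f (card (orbit p y))) + (\<Sum>y\<in>orbit p x. f (card (orbit p y)))"
    by (rule sum.subset_diff) (use o orbit(1) perm_on_finite in auto)
  also have "(\<Sum>y\<in>orbit p x. f (card (orbit p y))) = (\<Sum>y\<in>orbit p x. f (card (orbit p x)))"
    using orbit_eq_perm_on[OF orbit(1,2)] by (intro sum.cong) auto
  finally show ?case
    using orbit(3) cycle_type_Diff[OF orbit(1) o] cycle_type_orbit[OF orbit(1,2)]
    by (simp add: add.commute)
qed simp

lemma sum_mset_cycle_type: "perm_on A p \<Longrightarrow> sum_mset (cycle_type A p) = card A"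
  using sum_cycle_type_weighted[of A p "\<lambda>_. 1::nat"] by simp

lemma cycle_type_uniform:
  assumes "perm_on A p" "\<And>x. x \<in> A \<Longrightarrow> card (orbit p x) = k"
  obtains c where "cycle_type A p = replicate_mset c k" "c * k = card A"
proof
  have "set_mset (cycle_type A p) \<subseteq> {k}"
    using assms by (auto simp: in_cycle_type_iff perm_on_finite)
  then show *: "cycle_type A p = replicate_mset (size (cycle_type A p)) k"
    by (simp add: set_mset_subset_singletonD)
  show "size (cycle_type A p) * k = card A"
    using sum_mset_cycle_type[OF assms(1)] by (subst (asm) *) simp
qed

text \<open>Both cycles are enumerated by the iterates \<open>0, \<dots>, k - 1\<close> of a base point, where \<open>k\<close> is the common
length; matching the two enumerations intertwines \<open>p\<close> and \<open>q\<close>.\<close>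
lemma orbits_isomorphic:
  assumes p: "perm_on A p" "x \<in> A" and q: "perm_on B q" "y \<in> B"
    and card: "card (orbit p x) = card (orbit q y)"
  obtains h where "bij_betw h (orbit p x) (orbit q y)"
    "\<And>z. z \<in> orbit p x \<Longrightarrow> h (p z) = q (h z)"
proof -
  define k where "k = card (orbit p x)"
  have *: "bij_betw (\<lambda>i. (p ^^ i) x) {..<card (orbit p x)} (orbit p x) \<and> (p ^^ card (orbit p x)) x = x"
    if p: "perm_on A p" "x \<in> A" for A p and x :: 'c
  proof -
    have x: "x \<in> orbit p x" by (rule perm_on_self_in_orbit[OF that])
    have eq: "orbit p x = (\<lambda>i. (p ^^ i) x) ` {0..<funpow_dist1 p x x}"
      by (rule orbit_conv_funpow_dist1[OF x])
    have inj: "inj_on (\<lambda>i. (p ^^ i) x) {0..<funpow_dist1 p x x}"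
      by (rule inj_on_funpow_dist1[OF x])
    have c: "card (orbit p x) = funpow_dist1 p x x"
      by (subst eq) (simp add: card_image[OF inj] del: funpow.simps)
    show ?thesis
      unfolding c using eq inj funpow_dist1_prop[OF x] by (auto simp: bij_betw_def atLeast0LessThan)
  qed
  define f where "f = (\<lambda>i. (p ^^ i) x)"
  define g where "g = (\<lambda>i. (q ^^ i) y)"
  have f: "bij_betw f {..<k} (orbit p x)" "f k = f 0" and g: "bij_betw g {..<k} (orbit q y)" "g k = g 0"
    using *[OF p] *[OF q] card by (auto simp: f_def g_def k_def)
  define h where "h = g \<circ> the_inv_into {..<k} f"
  have hf: "h (f i) = g i" if "i < k" for i
    using that f(1) by (auto simp: h_def the_inv_into_f_f bij_betw_def)
  show ?thesis
  proof
    show "bij_betw h (orbit p x) (orbit q y)"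
      unfolding h_def by (rule bij_betw_trans[OF bij_betw_the_inv_into[OF f(1)] g(1)])
    fix z assume "z \<in> orbit p x"
    then obtain i where i: "i < k" "z = f i" using f(1) by (auto simp: bij_betw_def)
    have "p z = f (Suc i)" "q (g i) = g (Suc i)" using i by (auto simp: f_def g_def)
    moreover have "h (f (Suc i)) = g (Suc i)"
    proof (cases "Suc i < k")
      case False
      then have "Suc i = k" using i by simp
      then show ?thesis using f(2) g(2) hf[of 0] i by auto
    qed (rule hf)
    ultimately show "h (p z) = q (h z)" using hf i by simp
  qed
qed

text \<open>The classical fact that cycle types classify permutations up to conjugacy, for permutations of
possibly different sets: match up one cycle of each and recurse on the rest.\<close>
lemma same_cycle_type_conj:
  assumes "perm_on A p" "perm_on B q" "cycle_type A p = cycle_type B q"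
  obtains h where "bij_betw h A B" "\<forall>x\<in>A. h (p x) = q (h x)"
proof -
  have "\<exists>h. bij_betw h A B \<and> (\<forall>x\<in>A. h (p x) = q (h x))"
    using assms
  proof (induction arbitrary: B rule: perm_on_induct)
    case empty
    then have "B = {}"
      by (auto simp: cycle_type_def mset_set_empty_iff perm_on_finite)
    then show ?case by (auto simp: bij_betw_def)
  next
    case (orbit A x)
    have "card (orbit p x) \<in># cycle_type B q"
      using orbit by (auto simp: in_cycle_type_iff perm_on_finite simp flip: orbit(5))
    then obtain y where y: "y \<in> B" "card (orbit p x) = card (orbit q y)"
      using orbit(4) by (auto simp: in_cycle_type_iff perm_on_finite)
    let ?O = "orbit p x" and ?Q = "orbit q y"
    note O = perm_on_orbit[OF orbit(1,2)] orbit_subset_perm_on[OF orbit(1,2)]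
    note Q = perm_on_orbit[OF orbit(4) y(1)] orbit_subset_perm_on[OF orbit(4) y(1)]
    have "cycle_type (A - ?O) p = cycle_type (B - ?Q) q"
      using cycle_type_Diff[OF orbit(1) O] cycle_type_Diff[OF orbit(4) Q] y(2) orbit(5)
      by (simp add: cycle_type_orbit[OF orbit(1,2)] cycle_type_orbit[OF orbit(4) y(1)])
    then obtain h where h: "bij_betw h (A - ?O) (B - ?Q)" "\<forall>x\<in>A - ?O. h (p x) = q (h x)"
      using orbit(3)[OF perm_on_Diff[OF orbit(4) Q]] by blast
    obtain g where g: "bij_betw g ?O ?Q" "\<And>z. z \<in> ?O \<Longrightarrow> g (p z) = q (g z)"
      using orbits_isomorphic[OF orbit(1,2,4) y] by blast
    define f where "f = (\<lambda>z. if z \<in> ?O then g z else h z)"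
    have "bij_betw f (?O \<union> (A - ?O)) (?Q \<union> (B - ?Q))"
      unfolding f_def by (rule bij_betw_disjoint_Un[OF g(1) h(1)]) auto
    moreover have "f (p z) = q (f z)" if "z \<in> A" for z
      using that g(2) h(2) perm_on_in[OF O(1)] perm_on_in[OF perm_on_Diff[OF orbit(1) O]]
      by (cases "z \<in> ?O") (auto simp: f_def)
    ultimately show ?case using O Q by (auto simp: Un_absorb1)
  qed
  then show ?thesis using that by blast
qed

lemma cycle_type_insert:
  assumes A: "finite A" "a \<notin> A" and p: "p permutes A"
  shows "cycle_type (insert a A) p = add_mset 1 (cycle_type A p)"
proof -
  have [simp]: "orbit p a = {a}"
    using permutes_not_in[OF p A(2)] by (simp add: orbit_eq_singleton_iff)
  have "perm_on {a} p"
    using permutes_not_in[OF p A(2)] by (simp add: perm_on_def)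
  then have "cycle_type ({a} \<union> A) p = cycle_type {a} p + cycle_type A p"
    by (rule cycle_type_Un[OF _ permutes_perm_on[OF A(1) p]]) (simp add: A(2))
  then show ?thesis by (simp add: cycle_type_def)
qed

text \<open>Composing with the transposition of a fixed point \<open>a\<close> and \<open>b\<close> inserts \<open>a\<close> into the cycle of \<open>b\<close>, just
before \<open>b\<close>, and leaves all other cycles alone. Together with \<open>cycle_type_insert\<close> this describes how
the cycle type evolves when a permutation of \<open>n + 1\<close> points is built from one of \<open>n\<close> points.\<close>
lemma cycle_type_insert_transpose:
  assumes A: "finite A" "a \<notin> A" and p: "p permutes A" and b: "b \<in> A"
  shows "cycle_type (insert a A) (Transposition.transpose a b \<circ> p)
       = add_mset (Suc (card (orbit p b))) (cycle_type A p - {#card (orbit p b)#})"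
proof -
  let ?p = "Transposition.transpose a b \<circ> p" and ?O = "orbit p b"
  have perm: "perm_on A p" using A p by (simp add: permutes_perm_on)
  have O: "perm_on ?O p" "?O \<subseteq> A" "b \<in> ?O" "a \<notin> ?O"
    using perm_on_orbit[OF perm b] orbit_subset_perm_on[OF perm b] perm_on_self_in_orbit[OF perm b] A
    by auto
  have pa: "p a = a" by (rule permutes_not_in[OF p A(2)])
  have perm': "perm_on (insert a A) ?p"
    by (rule permutes_perm_on)
       (use A p b in \<open>auto intro!: permutes_compose[of p "insert a A"] permutes_swap_id
          intro: permutes_subset\<close>)
  have away: "?p z = p z" if "z \<in> A" "p z \<noteq> b" for z
    using that perm_on_in[OF perm] A by (auto simp: Transposition.transpose_def)
  \<comment> \<open>One inclusion holds because the right-hand side is invariant; for the other, the new orbit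
    contains \<open>b\<close>, the image of \<open>a\<close>, and is closed under \<open>p\<close> within \<open>A\<close>.\<close>
  have orb: "orbit ?p a = insert a ?O"
  proof
    have "perm_on (insert a ?O) ?p"
      by (rule perm_on_subset[OF perm'])
         (use O(2) O(3) perm_on_in[OF O(1)] pa in \<open>auto simp: Transposition.transpose_def\<close>)
    then show "orbit ?p a \<subseteq> insert a ?O" by (simp add: orbit_subset_perm_on)
  next
    have a: "a \<in> orbit ?p a" using perm_on_self_in_orbit[OF perm'] by simp
    have "?p a = b" by (simp add: pa)
    then have b': "b \<in> orbit ?p a" using orbit.base[of ?p a] by simp
    have step_p: "p y \<in> orbit ?p a" if "y \<in> orbit ?p a" "y \<in> A" for y
      using b' away[of y] orbit.step[OF that(1)] that by (cases "p y = b") auto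
    have "y \<in> orbit ?p a \<and> y \<in> A" if "y \<in> ?O" for y
      using that
    proof induction
      case base
      show ?case using step_p[OF b' b] perm_on_in[OF perm b] ..
    next
      case (step y)
      then show ?case using step_p[of y] perm_on_in[OF perm, of y] by blast
    qed
    then show "insert a ?O \<subseteq> orbit ?p a" using a by auto
  qed
  have ia: "a \<in> insert a A" by simp
  have D: "insert a A - orbit ?p a = A - ?O" using orb A by auto
  have f: "?p z = p z" if "z \<in> A - ?O" for z
  proof -
    have "p z \<in> A - ?O" using that perm_on_in[OF perm_on_Diff[OF perm O(1,2)]] by blast
    then have "p z \<noteq> b" using O(3) by auto
    then show ?thesis using that away by blast
  qed
  have "cycle_type (insert a A) ?p = cycle_type (orbit ?p a) ?p + cycle_type (insert a A - orbit ?p a) ?p"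
    by (rule cycle_type_Diff[OF perm' perm_on_orbit[OF perm' ia] orbit_subset_perm_on[OF perm' ia]])
  also have "cycle_type (insert a A - orbit ?p a) ?p = cycle_type (A - ?O) p"
    unfolding D using cycle_type_cong[OF perm_on_Diff[OF perm O(1,2)], of ?p] f by auto
  also have "cycle_type (orbit ?p a) ?p = {#Suc (card ?O)#}"
    using cycle_type_orbit[OF perm' ia] O(4) perm_on_finite[OF O(1)] unfolding orb by simp
  finally show ?thesis
    by (simp add: cycle_type_Diff[OF perm O(1,2)] cycle_type_orbit[OF perm b] del: o_apply)
qed


section \<open>Partitions weighted by the proportion of permutations of that type\<close>

lemma sum_image_mset_multiplicity:
  "sum_mset (image_mset f M) = (\<Sum>k\<in>set_mset M. of_nat (count M k) * (f k :: 'b :: comm_semiring_1))"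
proof -
  have "sum_mset (image_mset f M) = (\<Sum>k\<in>S. of_nat (count M k) * f k)"
    if "finite S" "set_mset M \<subseteq> S" for S
    using that(2)
  proof (induction M)
    case (add x M)
    have "(\<Sum>k\<in>S. of_nat (count (add_mset x M) k) * f k)
        = (\<Sum>k\<in>S. (if x = k then f k else 0) + of_nat (count M k) * f k)"
      by (rule sum.cong) (auto simp: algebra_simps)
    also have "\<dots> = f x + (\<Sum>k\<in>S. of_nat (count M k) * f k)"
      using add.prems that(1) by (simp add: sum.distrib)
    finally show ?case using add by simp
  qed simp
  then show ?thesis by simp
qed

definition partitions :: "nat \<Rightarrow> nat multiset set" where
  "partitions n = {M. 0 \<notin># M \<and> sum_mset M = n}"

text \<open>This is the proportion of permutations with cycle type \<open>M\<close>, the reciprocal of the order of their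
centralizer; see \<open>sum_over_cycle_types\<close>.\<close>
definition weight :: "nat multiset \<Rightarrow> real" where
  "weight M = (\<Prod>i\<in>set_mset M. 1 / (real i ^ count M i * fact (count M i)))"

lemma partitions_0 [simp]: "partitions 0 = {{#}}"
  by (auto simp: partitions_def) (metis multiset_nonemptyE)

lemma partitions_add: "U \<in> partitions m \<Longrightarrow> L \<in> partitions n \<Longrightarrow> U + L \<in> partitions (m + n)"
  by (auto simp: partitions_def)

lemma partitions_diff: "M \<in> partitions n \<Longrightarrow> U \<subseteq># M \<Longrightarrow> M - U \<in> partitions (n - sum_mset U)"
  by (auto simp: partitions_def sum_mset_diff dest: in_diffD)

lemma partitions_le: "M \<in> partitions n \<Longrightarrow> k \<in># M \<Longrightarrow> 0 < k \<and> k \<le> n"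
  by (auto simp: partitions_def intro!: Nat.gr0I dest: sum_mset.remove)

lemma finite_partitions [simp]: "finite (partitions n)"
proof (induction n rule: less_induct)
  case (less n)
  have "partitions n \<subseteq> {{#}} \<union> (\<Union>k\<in>{1..n}. add_mset k ` partitions (n - k))"
  proof
    fix M assume M: "M \<in> partitions n"
    show "M \<in> {{#}} \<union> (\<Union>k\<in>{1..n}. add_mset k ` partitions (n - k))"
    proof (cases "M = {#}")
      case False
      then obtain k where k: "k \<in># M" by auto
      then have "M = add_mset k (M - {#k#})" "M - {#k#} \<in> partitions (n - k)" "k \<in> {1..n}"
        using partitions_diff[OF M, of "{#k#}"] partitions_le[OF M k] by auto
      then show ?thesis by blast
    qed simp
  qed
  moreover have "finite (\<Union>k\<in>{1..n}. add_mset k ` partitions (n - k))"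
    using less by auto
  ultimately show ?case by (meson finite.emptyI finite_UnI finite.insertI finite_subset)
qed

lemma weight_superset:
  assumes "finite S" "set_mset M \<subseteq> S"
  shows "weight M = (\<Prod>i\<in>S. 1 / (real i ^ count M i * fact (count M i)))"
  unfolding weight_def by (rule prod.mono_neutral_left) (use assms in \<open>auto simp: not_in_iff\<close>)

lemma weight_nonneg [simp]: "weight M \<ge> 0"
  unfolding weight_def by (intro prod_nonneg) auto

lemma weight_empty [simp]: "weight {#} = 1"
  by (simp add: weight_def)

lemma weight_replicate: "weight (replicate_mset c k) = 1 / (real k ^ c * fact c)"
  by (cases "c = 0") (simp_all add: weight_def)

lemma weight_remove:
  assumes "k \<in># M" "k > 0"
  shows "weight (M - {#k#}) = real k * real (count M k) * weight M"
proof -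
  let ?f = "\<lambda>M i. 1 / (real i ^ count M i * fact (count M i))"
  let ?S = "set_mset M"
  have fin: "finite ?S" by simp
  obtain m where m: "count M k = Suc m"
    using assms(1) by (metis count_greater_zero_iff gr0_conv_Suc)
  have "weight (M - {#k#}) = (\<Prod>i\<in>?S. ?f (M - {#k#}) i)"
    by (rule weight_superset[OF fin]) (auto dest: in_diffD)
  also have "\<dots> = ?f (M - {#k#}) k * (\<Prod>i\<in>?S - {k}. ?f (M - {#k#}) i)"
    by (rule prod.remove[OF fin assms(1)])
  also have "(\<Prod>i\<in>?S - {k}. ?f (M - {#k#}) i) = (\<Prod>i\<in>?S - {k}. ?f M i)"
    by (rule prod.cong) auto
  also have "?f (M - {#k#}) k = real k * real (count M k) * ?f M k"
    using assms(2) by (simp add: m del: of_nat_Suc)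
  also have "\<dots> * (\<Prod>i\<in>?S - {k}. ?f M i) = real k * real (count M k) * (?f M k * (\<Prod>i\<in>?S - {k}. ?f M i))"
    by (simp only: mult.assoc)
  also have "?f M k * (\<Prod>i\<in>?S - {k}. ?f M i) = weight M"
    unfolding weight_def by (rule prod.remove[OF fin assms(1), symmetric])
  finally show ?thesis .
qed

text \<open>Equality would hold without the factorials, and \<open>a! * b! \<le> (a + b)!\<close>.\<close>
lemma weight_add_le: "weight (U + L) \<le> weight U * weight L"
proof -
  let ?f = "\<lambda>M i. 1 / (real i ^ count M i * fact (count M i))"
  let ?S = "set_mset U \<union> set_mset L"
  have "weight (U + L) = (\<Prod>i\<in>?S. ?f (U + L) i)"
    by (rule weight_superset) auto
  also have "\<dots> \<le> (\<Prod>i\<in>?S. ?f U i * ?f L i)"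
  proof (rule prod_mono)
    fix i assume "i \<in> ?S"
    have "fact (count U i) * fact (count L i) \<le> (fact (count U i + count L i) :: real)"
    proof -
      have "fact (count U i) * fact (count L i) dvd (fact (count U i + count L i) :: nat)"
        by (rule fact_fact_dvd_fact)
      then have "fact (count U i) * fact (count L i) \<le> (fact (count U i + count L i) :: nat)"
        by (rule dvd_imp_le) simp
      then show ?thesis by (metis of_nat_fact of_nat_le_iff of_nat_mult)
    qed
    then have "1 / fact (count U i + count L i) \<le> 1 / (fact (count U i) * fact (count L i) :: real)"
      by (intro divide_left_mono) auto
    then have "1 / (real i ^ count U i * real i ^ count L i) * (1 / fact (count U i + count L i))
        \<le> 1 / (real i ^ count U i * real i ^ count L i) * (1 / (fact (count U i) * fact (count L i)))"
      by (rule mult_left_mono) simp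
    then show "0 \<le> ?f (U + L) i \<and> ?f (U + L) i \<le> ?f U i * ?f L i"
      by (simp add: power_add mult_ac)
  qed
  also have "\<dots> = (\<Prod>i\<in>?S. ?f U i) * (\<Prod>i\<in>?S. ?f L i)"
    by (rule prod.distrib)
  also have "\<dots> = weight U * weight L"
    by (subst (1 2) weight_superset[of ?S]) auto
  finally show ?thesis .
qed

lemma weight_add_new:
  assumes "k \<notin># L" "k > 0" shows "weight (add_mset k L) = weight L / k"
  using weight_remove[of k "add_mset k L"] assms by (simp add: not_in_iff)

text \<open>A partition with one of its distinct part sizes marked is the same as a part size together with a
partition of the remainder.\<close>
lemma sum_marked_part:
  fixes g :: "nat \<Rightarrow> nat multiset \<Rightarrow> real"
  shows "(\<Sum>M\<in>partitions n. \<Sum>k\<in>set_mset M. g k (M - {#k#})) = (\<Sum>k=1..n. \<Sum>L\<in>partitions (n - k). g k L)"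
proof -
  have "(\<Sum>M\<in>partitions n. \<Sum>k\<in>set_mset M. g k (M - {#k#}))
      = (\<Sum>(M,k)\<in>Sigma (partitions n) set_mset. g k (M - {#k#}))"
    by (rule sum.Sigma) auto
  also have "\<dots> = (\<Sum>(k,L)\<in>Sigma {1..n} (\<lambda>k. partitions (n - k)). g k L)"
  proof (rule sum.reindex_bij_witness[where i = "\<lambda>(k,L). (add_mset k L, k)" and j = "\<lambda>(M,k). (k, M - {#k#})"], goal_cases)
    case (2 a)
    then show ?case
      using partitions_diff[of "fst a" n "{#snd a#}"] partitions_le[of "fst a" n "snd a"] by auto
  next
    case (4 b)
    then show ?case
      using partitions_add[of "{#fst b#}" "fst b" "snd b" "n - fst b"]
      by (auto simp: partitions_def)
  qed auto
  also have "\<dots> = (\<Sum>k=1..n. \<Sum>L\<in>partitions (n - k). g k L)"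
    by (rule sum.Sigma[symmetric]) auto
  finally show ?thesis .
qed

text \<open>By \<open>weight_remove\<close>, deleting a part \<open>k\<close> multiplies the weight by \<open>k\<close> times its multiplicity, and these
factors add up to \<open>n\<close>.\<close>
lemma weight_marked:
  assumes "M \<in> partitions n"
  shows "(\<Sum>k\<in>set_mset M. weight (M - {#k#})) = real n * weight M"
proof -
  have "(\<Sum>k\<in>set_mset M. weight (M - {#k#})) = (\<Sum>k\<in>set_mset M. real (count M k * k) * weight M)"
    using partitions_le[OF assms] by (intro sum.cong) (auto simp: weight_remove)
  also have "\<dots> = real (\<Sum>k\<in>set_mset M. count M k * k) * weight M"
    by (simp add: sum_distrib_right)
  also have "(\<Sum>k\<in>set_mset M. count M k * k) = n"
    using assms sum_image_mset_multiplicity[of "\<lambda>k. k" M] by (simp add: partitions_def)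
  finally show ?thesis .
qed

text \<open>In probabilistic terms: the cycle through a given point has each length \<open>k \<le> n\<close> with probability
\<open>1/n\<close>, and what remains is uniformly distributed. It is derived here from the formula for the weights
alone, since it is used to prove that they are the proportions.\<close>
lemma weighted_sum_recursion:
  fixes F :: "nat multiset \<Rightarrow> real"
  shows "real n * (\<Sum>M\<in>partitions n. weight M * F M)
    = (\<Sum>k=1..n. \<Sum>L\<in>partitions (n - k). weight L * F (add_mset k L))"
proof -
  have "real n * (\<Sum>M\<in>partitions n. weight M * F M)
      = (\<Sum>M\<in>partitions n. \<Sum>k\<in>set_mset M. weight (M - {#k#}) * F M)"
    by (simp add: sum_distrib_left weight_marked flip: sum_distrib_right mult.assoc)
  also have "\<dots> = (\<Sum>M\<in>partitions n. \<Sum>k\<in>set_mset M. weight (M - {#k#}) * F (add_mset k (M - {#k#})))"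
    by (intro sum.cong) auto
  also have "\<dots> = (\<Sum>k=1..n. \<Sum>L\<in>partitions (n - k). weight L * F (add_mset k L))"
    by (rule sum_marked_part)
  finally show ?thesis .
qed

definition small_parts_weight :: "nat \<Rightarrow> nat \<Rightarrow> real" where
  "small_parts_weight r n = (\<Sum>M | M \<in> partitions n \<and> (\<forall>k\<in>#M. k \<le> r). weight M)"

lemma small_parts_weight_recursion:
  "real n * small_parts_weight r n = (\<Sum>k=1..min r n. small_parts_weight r (n - k))"
proof -
  let ?F = "\<lambda>M. if \<forall>k\<in>#M. k \<le> r then 1 else 0 :: real"
  have *: "small_parts_weight r n = (\<Sum>M\<in>partitions n. weight M * ?F M)" for n
    unfolding small_parts_weight_def by (rule sum.mono_neutral_cong_left) auto
  have "real n * small_parts_weight r n = (\<Sum>k=1..n. \<Sum>L\<in>partitions (n - k). weight L * ?F (add_mset k L))"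
    unfolding * by (rule weighted_sum_recursion)
  also have "\<dots> = (\<Sum>k=1..n. if k \<le> r then small_parts_weight r (n - k) else 0)"
    unfolding * by (intro sum.cong) auto
  also have "\<dots> = (\<Sum>k=1..min r n. small_parts_weight r (n - k))"
    by (rule sum.mono_neutral_cong_right) auto
  finally show ?thesis .
qed

text \<open>Here \<open>small_parts_weight r n\<close> is the proportion of permutations all of whose cycles have length at
most \<open>r\<close>. By the recursion it is the sum of at most \<open>r\<close> earlier values divided by \<open>n\<close>, and each of
these values is, for \<open>n \<ge> r\<close>, at most \<open>1 / (n div r - 1)!\<close> by induction, while \<open>r / n \<le> 1 / (n div r)\<close>.\<close>
lemma small_parts_weight_le:
  assumes "r > 0"
  shows "small_parts_weight r n \<le> 1 / fact (n div r)"
proof (induction n rule: less_induct)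
  case (less n)
  show ?case
  proof (cases "n = 0")
    case True
    have "{M. M \<in> partitions 0 \<and> (\<forall>k\<in>#M. k \<le> r)} = {{#}}" by auto
    then show ?thesis by (simp add: True small_parts_weight_def)
  next
    case False
    define t where "t = n div r"
    have "real n * small_parts_weight r n = (\<Sum>k=1..min r n. small_parts_weight r (n - k))"
      by (rule small_parts_weight_recursion)
    also have "\<dots> \<le> (\<Sum>k=1..min r n. 1 / fact (t - 1))"
    proof (rule sum_mono)
      fix k assume k: "k \<in> {1..min r n}"
      have "t - 1 = (n - r) div r" unfolding t_def using assms by (cases "r \<le> n") (simp_all add: le_div_geq)
      also have "\<dots> \<le> (n - k) div r" using k by (intro div_le_mono) auto
      finally have "fact (t - 1) \<le> (fact ((n - k) div r) :: real)" by (rule fact_mono)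
      then have "1 / fact ((n - k) div r) \<le> (1 / fact (t - 1) :: real)" by (simp add: frac_le)
      then show "small_parts_weight r (n - k) \<le> 1 / fact (t - 1)"
        using less[of "n - k"] k False by auto
    qed
    also have "\<dots> = real (min r n) / fact (t - 1)" by simp
    also have "\<dots> \<le> real n / fact t"
    proof (cases "t = 0")
      case False
      have "real r * real t \<le> real n"
        by (simp add: t_def flip: of_nat_mult)
      moreover have "fact t = real t * fact (t - 1)" using False by (simp add: fact_reduce)
      moreover have "real (min r n) * real t \<le> real r * real t"
        by (rule mult_right_mono) simp_all
      ultimately have "real (min r n) * real t \<le> real n" and fact: "fact t = real t * fact (t - 1)"
        by linarith+
      then have "real (min r n) * real t / fact t \<le> real n / fact t"
        by (intro divide_right_mono) simp_all
      then show ?thesis using False by (simp add: fact)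
    qed simp
    finally show ?thesis using False by (simp add: t_def field_simps)
  qed
qed


section \<open>The distribution of the cycle type\<close>

text \<open>The weights are the proportions, stated for arbitrary class functions \<open>F\<close> because the induction
over the ground set replaces \<open>F\<close> by a sum over the ways to insert a new point \<open>a\<close>. The new
point either becomes a cycle of its own or lengthens a cycle of length \<open>l\<close>, the latter in \<open>l\<close> ways per
cycle. Deleting the lengthened cycle turns the second kind into the terms \<open>k = l + 1 \<ge> 2\<close> of
\<open>weighted_sum_recursion\<close>; the first kind is the term \<open>k = 1\<close>.\<close>
lemma sum_over_cycle_types:
  fixes F :: "nat multiset \<Rightarrow> real"
  assumes "finite A"
  shows "(\<Sum>p | p permutes A. F (cycle_type A p))
    = fact (card A) * (\<Sum>M\<in>partitions (card A). weight M * F M)"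
  using assms
proof (induction A arbitrary: F rule: finite_induct)
  case empty
  then show ?case by (simp add: permutes_empty)
next
  case (insert a A)
  let ?n = "card A"
  let ?P = "{p. p permutes A}"
  \<comment> \<open>The total contribution of lengthening a cycle of a permutation of type \<open>M\<close>.\<close>
  define G where "G = (\<lambda>M. \<Sum>l\<in>#M. real l * F (add_mset (Suc l) (M - {#l#})))"
  have "(\<Sum>p | p permutes insert a A. F (cycle_type (insert a A) p))
      = (\<Sum>b\<in>insert a A. \<Sum>q\<in>?P. F (cycle_type (insert a A) (Transposition.transpose a b \<circ> q)))"
    using insert(1,2) by (rule sum_over_permutations_insert)
  also have "\<dots> = (\<Sum>q\<in>?P. F (cycle_type (insert a A) (Transposition.transpose a a \<circ> q)))
      + (\<Sum>b\<in>A. \<Sum>q\<in>?P. F (cycle_type (insert a A) (Transposition.transpose a b \<circ> q)))"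
    by (rule sum.insert[OF insert(1,2)])
  also have "(\<Sum>q\<in>?P. F (cycle_type (insert a A) (Transposition.transpose a a \<circ> q)))
      = (\<Sum>q\<in>?P. F (add_mset 1 (cycle_type A q)))"
    by (rule sum.cong[OF refl]) (simp add: cycle_type_insert[OF insert(1,2)])
  also have "\<dots> = fact ?n * (\<Sum>M\<in>partitions ?n. weight M * F (add_mset 1 M))"
    by (rule insert.IH)
  also have "(\<Sum>b\<in>A. \<Sum>q\<in>?P. F (cycle_type (insert a A) (Transposition.transpose a b \<circ> q)))
      = (\<Sum>q\<in>?P. \<Sum>b\<in>A. F (cycle_type (insert a A) (Transposition.transpose a b \<circ> q)))"
    by (rule sum.swap)
  also have "\<dots> = (\<Sum>q\<in>?P. G (cycle_type A q))"
  proof (rule sum.cong[OF refl])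
    fix q assume "q \<in> ?P"
    then have q: "q permutes A" by simp
    have "(\<Sum>b\<in>A. F (cycle_type (insert a A) (Transposition.transpose a b \<circ> q)))
        = (\<Sum>b\<in>A. F (add_mset (Suc (card (orbit q b))) (cycle_type A q - {#card (orbit q b)#})))"
      by (rule sum.cong[OF refl]) (simp only: cycle_type_insert_transpose[OF insert(1,2) q])
    also have "\<dots> = G (cycle_type A q)"
      unfolding G_def by (rule sum_cycle_type_weighted[OF permutes_perm_on[OF insert(1) q]])
    finally show "(\<Sum>b\<in>A. F (cycle_type (insert a A) (Transposition.transpose a b \<circ> q))) = G (cycle_type A q)" .
  qed
  also have "\<dots> = fact ?n * (\<Sum>M\<in>partitions ?n. weight M * G M)"
    by (rule insert.IH)
  also have "(\<Sum>M\<in>partitions ?n. weight M * G M)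
      = (\<Sum>M\<in>partitions ?n. \<Sum>l\<in>set_mset M. weight (M - {#l#}) * F (add_mset (Suc l) (M - {#l#})))"
  proof (rule sum.cong[OF refl])
    fix M assume M: "M \<in> partitions ?n"
    have "weight M * G M = (\<Sum>l\<in>set_mset M. weight M * (real (count M l) * (real l * F (add_mset (Suc l) (M - {#l#})))))"
      by (simp add: G_def sum_image_mset_multiplicity sum_distrib_left)
    also have "\<dots> = (\<Sum>l\<in>set_mset M. weight (M - {#l#}) * F (add_mset (Suc l) (M - {#l#})))"
      using partitions_le[OF M] by (intro sum.cong refl) (simp add: weight_remove)
    finally show "weight M * G M = \<dots>" .
  qed
  also have "\<dots> = (\<Sum>l=1..?n. \<Sum>L\<in>partitions (?n - l). weight L * F (add_mset (Suc l) L))"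
    by (rule sum_marked_part)
  also have "fact ?n * (\<Sum>M\<in>partitions ?n. weight M * F (add_mset 1 M)) + fact ?n * \<dots>
      = fact ?n * (\<Sum>k=1..Suc ?n. \<Sum>L\<in>partitions (Suc ?n - k). weight L * F (add_mset k L))"
  proof -
    have "(\<Sum>k=1..Suc ?n. \<Sum>L\<in>partitions (Suc ?n - k). weight L * F (add_mset k L))
        = (\<Sum>M\<in>partitions ?n. weight M * F (add_mset 1 M))
        + (\<Sum>k=Suc 1..Suc ?n. \<Sum>L\<in>partitions (Suc ?n - k). weight L * F (add_mset k L))"
      by (subst sum.atLeast_Suc_atMost) simp_all
    then show ?thesis
      by (simp only: sum.shift_bounds_cl_Suc_ivl diff_Suc_Suc distrib_left)
  qed
  also have "(\<Sum>k=1..Suc ?n. \<Sum>L\<in>partitions (Suc ?n - k). weight L * F (add_mset k L))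
      = real (Suc ?n) * (\<Sum>M\<in>partitions (Suc ?n). weight M * F M)"
    by (rule weighted_sum_recursion[symmetric])
  also have "fact ?n * \<dots> = fact (Suc ?n) * (\<Sum>M\<in>partitions (Suc ?n). weight M * F M)"
    by (simp add: algebra_simps)
  finally show ?case using insert(1,2) by simp
qed


section \<open>Rectangular partitions\<close>

text \<open>Partitions of \<open>m\<close> into equal parts: the cycle types of a permutation on an orbit of size \<open>m\<close> of an
abelian permutation group that contains it.\<close>
definition rect_partitions :: "nat \<Rightarrow> nat multiset set" where
  "rect_partitions m = {M \<in> partitions m. \<exists>c k. M = replicate_mset c k}"

lemma finite_rect_partitions [simp]: "finite (rect_partitions m)"
  by (simp add: rect_partitions_def)

definition rect_weight :: "nat \<Rightarrow> real" where
  "rect_weight m = sum weight (rect_partitions m)"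

lemma rect_partitions_eq:
  assumes "m > 0"
  shows "rect_partitions m = (\<lambda>c. replicate_mset c (m div c)) ` {c. c dvd m}"
proof (intro equalityI subsetI)
  fix M assume "M \<in> rect_partitions m"
  then obtain c k where M: "M = replicate_mset c k" and m: "m = c * k"
    by (auto simp: rect_partitions_def partitions_def)
  then have "k = m div c" "c dvd m" using assms by auto
  then show "M \<in> (\<lambda>c. replicate_mset c (m div c)) ` {c. c dvd m}" using M by auto
qed (use assms in \<open>auto simp: rect_partitions_def partitions_def dvd_div_eq_0_iff\<close>)

text \<open>With \<open>c\<close> equal parts the weight is \<open>1 / (k ^ c * c!)\<close>. For \<open>c \<ge> 3\<close> only the factors
\<open>k\<^sup>3 * c * (c - 1) * (c - 2)\<close> of the denominator are kept, and \<open>c\<^sup>3 \<le> 6 * c * (c - 1) * (c - 2)\<close>.\<close>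
lemma rect_term_le:
  assumes "c * k = m" "k > 0" "c \<ge> 2"
  shows "1 / (real k ^ c * fact c) \<le> (if c = 2 then 2 / (real m)\<^sup>2 else 6 / (real m) ^ 3)"
proof (cases "c = 2")
  case True
  then show ?thesis using assms(1) by (auto simp: field_simps power2_eq_square)
next
  case False
  define j where "j = c - 3"
  have c: "c = j + 3" using assms(3) False by (simp add: j_def)
  have "real m ^ 3 = real k ^ 3 * real c ^ 3"
    by (simp add: assms(1)[symmetric] power_mult_distrib)
  also have "real c ^ 3 \<le> 6 * (real c * (real c - 1) * (real c - 2))"
  proof -
    have "6 * (real c * (real c - 1) * (real c - 2)) - real c ^ 3
      = 5 * real j ^ 3 + 27 * real j ^ 2 + 39 * real j + 9"
      by (simp add: c algebra_simps power3_eq_cube power2_eq_square)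
    also have "\<dots> \<ge> 0" by simp
    finally show ?thesis by simp
  qed
  also have "real c * (real c - 1) * (real c - 2) \<le> fact c"
  proof -
    have "fact c = real (j + 3) * real (j + 2) * real (j + 1) * fact j"
      by (simp add: c numeral_3_eq_3 algebra_simps)
    moreover have "real c * (real c - 1) * (real c - 2) = real (j + 3) * real (j + 2) * real (j + 1)"
      by (simp add: c algebra_simps)
    moreover have "real (j + 3) * real (j + 2) * real (j + 1) * 1
        \<le> real (j + 3) * real (j + 2) * real (j + 1) * fact j"
      by (rule mult_left_mono) (simp_all only: fact_ge_1 mult_nonneg_nonneg of_nat_0_le_iff)
    ultimately show ?thesis by (simp only: mult_1_right)
  qed
  also have "real k ^ 3 \<le> real k ^ c"
    using assms(2) by (intro power_increasing) (auto simp: c)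
  finally have "real m ^ 3 \<le> 6 * (real k ^ c * fact c)"
    by (simp add: mult_ac mult_left_mono mult_right_mono)
  moreover have "m > 0" using assms by auto
  ultimately show ?thesis using False assms by (simp add: field_simps)
qed

text \<open>The terms with \<open>c = 1\<close> and \<open>c = 2\<close> parts give \<open>1/m\<close> and \<open>2/m\<^sup>2\<close>. The others are at most \<open>6/m\<^sup>3\<close> each,
and \<open>m\<close> has at most \<open>m\<close> divisors.\<close>
lemma rect_weight_le:
  assumes "m > 0"
  shows "rect_weight m \<le> 1 / m + 8 / (real m)\<^sup>2"
proof -
  let ?t = "\<lambda>c. 1 / (real (m div c) ^ c * fact c)"
  have fin: "finite {c. c dvd m}" using assms by simp
  have "rect_weight m \<le> (\<Sum>c | c dvd m. weight (replicate_mset c (m div c)))"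
    unfolding rect_weight_def rect_partitions_eq[OF assms] using sum_image_le[OF fin, of weight] by (simp add: o_def)
  also have "\<dots> = (\<Sum>c | c dvd m. ?t c)"
    by (simp add: weight_replicate)
  also have "\<dots> \<le> (\<Sum>c | c dvd m. (if c = 1 then 1 / m else 0) + (if c = 2 then 2 / (real m)\<^sup>2 else 0) + 6 / (real m) ^ 3)"
  proof (rule sum_mono)
    fix c assume "c \<in> {c. c dvd m}"
    then have eq: "c * (m div c) = m" by simp
    have "m div c > 0" using eq assms by (cases "m div c = 0") simp_all
    have "c > 0" using eq assms by (cases "c = 0") simp_all
    show "?t c \<le> (if c = 1 then 1 / m else 0) + (if c = 2 then 2 / (real m)\<^sup>2 else 0) + 6 / (real m) ^ 3"
    proof (cases "c = 1")
      case True
      then show ?thesis by simp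
    next
      case False
      then have le: "?t c \<le> (if c = 2 then 2 / (real m)\<^sup>2 else 6 / (real m) ^ 3)"
        using \<open>c > 0\<close> by (intro rect_term_le[OF eq \<open>m div c > 0\<close>]) linarith
      show ?thesis by (rule order_trans[OF le]) (simp add: False)
    qed
  qed
  also have "\<dots> \<le> 1 / m + 2 / (real m)\<^sup>2 + card {c. c dvd m} * (6 / real m ^ 3)"
  proof -
    have "(\<Sum>c | c dvd m. if c = k then x else 0) \<le> x" if "x \<ge> 0" for k and x :: real
      by (subst sum.delta[OF fin]) (simp add: that)
    from this[of "1 / m" 1] this[of "2 / (real m)\<^sup>2" 2] show ?thesis
      unfolding sum.distrib sum_constant by (intro add_mono) simp_all
  qed
  also have "card {c. c dvd m} * (6 / real m ^ 3) \<le> m * (6 / real m ^ 3)"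
  proof -
    have "card {c. c dvd m} \<le> card {1..m}"
    proof (intro card_mono subsetI)
      fix c assume "c \<in> {c. c dvd m}"
      then show "c \<in> {1..m}"
        using dvd_imp_le[OF _ assms] dvd_pos_nat[OF assms] by (simp add: Suc_le_eq)
    qed simp
    then show ?thesis by (intro mult_right_mono) simp_all
  qed
  also have "1 / m + 2 / (real m)\<^sup>2 + m * (6 / real m ^ 3) = 1 / m + 8 / (real m)\<^sup>2"
    using assms by (simp add: field_simps power2_eq_square power3_eq_cube)
  finally show ?thesis by simp
qed

section \<open>Cycle types of commuting permutations\<close>

text \<open>The ground set is existentially quantified, so that orbits can be deleted and cycles added without
relabelling the points; natural numbers as points leave room for a disjoint new cycle.\<close>
definition commuting_types :: "nat multiset \<Rightarrow> nat multiset \<Rightarrow> bool" where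
  "commuting_types M N \<longleftrightarrow> (\<exists>(A :: nat set) p q. perm_on A p \<and> perm_on A q
     \<and> (\<forall>x\<in>A. p (q x) = q (p x)) \<and> cycle_type A p = M \<and> cycle_type A q = N)"

lemma commuting_typesI:
  fixes A :: "nat set"
  assumes "perm_on A p" "perm_on A q" "\<And>x. x \<in> A \<Longrightarrow> p (q x) = q (p x)"
  shows "commuting_types (cycle_type A p) (cycle_type A q)"
  unfolding commuting_types_def
  by (rule exI[of _ A], rule exI[of _ p], rule exI[of _ q]) (simp add: assms)

lemma commuting_typesE:
  assumes "commuting_types M N"
  obtains A :: "nat set" and p q where "perm_on A p" "perm_on A q"
    "\<forall>x\<in>A. p (q x) = q (p x)" "cycle_type A p = M" "cycle_type A q = N"
  using assms unfolding commuting_types_def by (elim exE conjE) (rule that)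

lemma commuting_types_sym: "commuting_types M N \<Longrightarrow> commuting_types N M"
  unfolding commuting_types_def by metis

text \<open>Let \<open>x\<close> lie on a cycle of \<open>p\<close> of length \<open>k\<close> and let \<open>X\<close> be its orbit under the group generated by \<open>p\<close>
and \<open>q\<close>. As powers of \<open>q\<close> commute with \<open>p\<close>, they carry cycles of \<open>p\<close> to cycles of \<open>p\<close>, so all cycles of
\<open>p\<close> inside \<open>X\<close> have length \<open>k\<close>; symmetrically all cycles of \<open>q\<close> inside \<open>X\<close> have equal length. Deleting
\<open>X\<close> leaves a commuting pair.\<close>
lemma commuting_types_split:
  assumes "commuting_types M N" "k \<in># M"
  obtains c d b where "c > 0" "d > 0" "b > 0" "k > 0" "c * k = d * b" "replicate_mset c k \<subseteq># M" "replicate_mset d b \<subseteq># N"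
    "commuting_types (M - replicate_mset c k) (N - replicate_mset d b)"
proof -
  obtain A :: "nat set" and p q where p: "perm_on A p" and q: "perm_on A q"
    and "\<forall>x\<in>A. p (q x) = q (p x)" and "cycle_type A p = M" "cycle_type A q = N"
    using assms(1) by (rule commuting_typesE)
  then have comm: "\<And>x. x \<in> A \<Longrightarrow> p (q x) = q (p x)"
    and M: "M = cycle_type A p" and N: "N = cycle_type A q" by simp_all
  obtain x where x: "x \<in> A" "k = card (orbit p x)"
    using assms(2) p by (auto simp: M in_cycle_type_iff perm_on_finite)
  \<comment> \<open>Since \<open>p\<close> and \<open>q\<close> commute, closing the \<open>p\<close>-cycle of \<open>x\<close> under \<open>q\<close> already gives the orbit of the group.\<close>
  define X where "X = (\<Union>y\<in>orbit p x. orbit q y)"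
  have px: "y \<in> A" if "y \<in> orbit p x" for y
    using that orbit_subset_perm_on[OF p x(1)] by blast
  have sub: "X \<subseteq> A"
    using orbit_subset_perm_on[OF q px] by (auto simp: X_def)
  have qX: "perm_on X q"
    by (rule perm_on_subset[OF q sub]) (auto simp: X_def intro: orbit.step)
  have pn: "p ((q ^^ n) y) = (q ^^ n) (p y)" if "y \<in> A" for n y
    by (induction n) (use that comm perm_on_in[OF perm_on_funpow[OF q]] in auto)
  have qn: "q ((p ^^ n) y) = (p ^^ n) (q y)" if "y \<in> A" for n y
    by (induction n) (use that comm perm_on_in[OF perm_on_funpow[OF p]] in \<open>auto simp flip: comm\<close>)
  have pX: "perm_on X p"
    by (rule perm_on_subset[OF p sub]) 
      (auto simp: X_def orbit_altdef[of q] pn px intro!: bexI[OF _ orbit.step])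
  have cp: "card (orbit p z) = k" if z: "z \<in> X" for z
  proof -
    obtain y n where y: "y \<in> orbit p x" "z = (q ^^ n) y"
      using z unfolding X_def orbit_altdef[of q] by blast
    have "orbit p z = (q ^^ n) ` orbit p y"
      unfolding y(2) by (rule orbit_conj[OF p px[OF y(1)]]) (simp add: pn)
    then have "orbit p z = (q ^^ n) ` orbit p x"
      using orbit_eq_perm_on[OF p x(1) y(1)] by simp
    then show ?thesis
      using card_image[OF inj_on_subset[OF perm_on_inj[OF perm_on_funpow[OF q]] orbit_subset_perm_on[OF p x(1)]]] x
      by simp
  qed
  have cq: "card (orbit q z) = card (orbit q x)" if z: "z \<in> X" for z
  proof -
    obtain y n where y: "y \<in> orbit p x" "z \<in> orbit q y" "y = (p ^^ n) x"
      using z unfolding X_def orbit_altdef[of p] by blast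
    have "orbit q z = orbit q ((p ^^ n) x)"
      using orbit_eq_perm_on[OF q px[OF y(1)] y(2)] y(3) by simp
    also have "\<dots> = (p ^^ n) ` orbit q x"
      by (rule orbit_conj[OF q x(1)]) (simp add: qn)
    finally show ?thesis
      using card_image[OF inj_on_subset[OF perm_on_inj[OF perm_on_funpow[OF p]] orbit_subset_perm_on[OF q x(1)]]] x
      by simp
  qed
  have xX: "x \<in> X"
    using perm_on_self_in_orbit[OF p x(1)] perm_on_self_in_orbit[OF q x(1)] by (auto simp: X_def)
  then have X0: "card X > 0" using perm_on_finite[OF pX] by (auto simp: card_gt_0_iff)
  obtain c where c: "cycle_type X p = replicate_mset c k" "c * k = card X"
    using cycle_type_uniform[OF pX cp] by blast
  obtain d where d: "cycle_type X q = replicate_mset d (card (orbit q x))" "d * card (orbit q x) = card X"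
    using cycle_type_uniform[OF qX cq] by blast
  have M': "M = replicate_mset c k + cycle_type (A - X) p"
    unfolding M using cycle_type_Diff[OF p pX sub] c by simp
  have N': "N = replicate_mset d (card (orbit q x)) + cycle_type (A - X) q"
    unfolding N using cycle_type_Diff[OF q qX sub] d by simp
  show ?thesis
  proof
    show "c * k = d * card (orbit q x)" using c d by simp
    show "c > 0" "d > 0" "card (orbit q x) > 0" "k > 0" using c(2) d(2) X0 by (auto intro!: Nat.gr0I)
    show "replicate_mset c k \<subseteq># M" "replicate_mset d (card (orbit q x)) \<subseteq># N"
      by (simp_all add: M' N')
    show "commuting_types (M - replicate_mset c k) (N - replicate_mset d (card (orbit q x)))"
    proof -
      have "commuting_types (cycle_type (A - X) p) (cycle_type (A - X) q)"
        by (rule commuting_typesI[OF perm_on_Diff[OF p pX sub] perm_on_Diff[OF q qX sub]])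
           (simp add: comm)
      then show ?thesis by (simp add: M' N')
    qed
  qed
qed

lemma cyclic_shift_on_interval:
  fixes m k :: nat
  assumes "k > 0"
  defines "c \<equiv> \<lambda>z. if Suc z < m + k then Suc z else m"
  shows "perm_on {m..<m + k} c" "cycle_type {m..<m + k} c = {#k#}"
proof -
  show c: "perm_on {m..<m + k} c"
  proof (rule perm_onI)
    show "inj_on c {m..<m + k}" by (rule inj_onI) (auto simp: c_def split: if_splits)
  qed (use assms(1) in \<open>auto simp: c_def\<close>)
  have m: "m \<in> {m..<m + k}" using assms(1) by simp
  have step: "m + i \<in> orbit c m" if "i < k" for i
    using that
  proof (induction i)
    case 0
    then show ?case using perm_on_self_in_orbit[OF c m] by simp
  next
    case (Suc i)
    then have "c (m + i) \<in> orbit c m" by (intro orbit.step) simp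
    then show ?case using Suc.prems by (simp add: c_def)
  qed
  have "z \<in> orbit c m" if "z \<in> {m..<m + k}" for z
    using step[of "z - m"] that by auto
  then have "orbit c m = {m..<m + k}"
    using orbit_subset_perm_on[OF c m] by blast
  then show "cycle_type {m..<m + k} c = {#k#}"
    using cycle_type_orbit[OF c m] by simp
qed

text \<open>Add to both permutations the same cycle on new points.\<close>
lemma commuting_types_add_mset:
  assumes "commuting_types M N" "k > 0"
  shows "commuting_types (add_mset k M) (add_mset k N)"
proof -
  obtain A :: "nat set" and p q where p: "perm_on A p" and q: "perm_on A q"
    and comm: "\<forall>x\<in>A. p (q x) = q (p x)"
    and M: "cycle_type A p = M" and N: "cycle_type A q = N"
    using assms(1) by (rule commuting_typesE)
  obtain m where m: "A \<subseteq> {..<m}"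
    using finite_nat_bounded[OF perm_on_finite[OF p]] by auto
  define B where "B = {m..<m + k}"
  have AB: "A \<inter> B = {}" using m by (auto simp: B_def)
  obtain c where c: "perm_on B c" "cycle_type B c = {#k#}"
    using cyclic_shift_on_interval[OF assms(2)] unfolding B_def by blast
  define glue where "glue = (\<lambda>f z. if z \<in> A then f z else c z)"
  have glue: "perm_on A (glue f)" "perm_on B (glue f)" "cycle_type (A \<union> B) (glue f) = add_mset k (cycle_type A f)"
    if f: "perm_on A f" for f
  proof -
    have fA: "f x = glue f x" if "x \<in> A" for x using that by (simp add: glue_def)
    have fB: "c x = glue f x" if "x \<in> B" for x using that AB by (auto simp: glue_def)
    show 1: "perm_on A (glue f)" by (rule perm_on_cong[OF f fA])
    show 2: "perm_on B (glue f)" by (rule perm_on_cong[OF c(1) fB])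
    show "cycle_type (A \<union> B) (glue f) = add_mset k (cycle_type A f)"
    proof -
      have "cycle_type A (glue f) = cycle_type A f"
        by (rule cycle_type_cong[OF f, symmetric]) (rule fA)
      moreover have "cycle_type B (glue f) = cycle_type B c"
        by (rule cycle_type_cong[OF c(1), symmetric]) (rule fB)
      ultimately show ?thesis by (simp add: cycle_type_Un[OF 1 2 AB] c(2))
    qed
  qed
  have perm: "perm_on (A \<union> B) (glue f)" if "perm_on A f" for f
    using glue(1,2)[OF that] by (auto simp: perm_on_def image_Un)
  have comm_glue: "glue p (glue q x) = glue q (glue p x)" if "x \<in> A \<union> B" for x
  proof (cases "x \<in> A")
    case True
    then show ?thesis using perm_on_in[OF p True] perm_on_in[OF q True] comm by (simp add: glue_def)
  next
    case False
    then have "c x \<notin> A" using that perm_on_in[OF c(1), of x] AB by auto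
    then show ?thesis using False by (simp add: glue_def)
  qed
  show ?thesis
    using commuting_typesI[OF perm[OF p] perm[OF q] comm_glue] by (simp only: glue(3)[OF p] glue(3)[OF q] M N)
qed


section \<open>Commuting conjugates in symmetric groups\<close>

text \<open>For the backward direction the intertwining bijection from \<open>same_cycle_type_conj\<close> is extended by the
identity to an element of the symmetric group.\<close>
lemma conjugates_sym_group_iff:
  assumes p: "p permutes {1..n}"
  shows "x \<in> conjugates (sym_group n) p
    \<longleftrightarrow> x permutes {1..n} \<and> cycle_type {1..n} x = cycle_type {1..n} p"
proof
  assume "x \<in> conjugates (sym_group n) p"
  then obtain g where g: "g permutes {1..n}" and x: "x = g \<circ> p \<circ> inv' g"
    by (auto simp: conjugates_def sym_group_carrier sym_group_mult)
  have "cycle_type (g ` {1..n}) x = cycle_type {1..n} p"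
    by (rule cycle_type_conj[OF permutes_perm_on[OF _ p] permutes_inj_on[OF g]])
       (simp_all add: x permutes_inverses(2)[OF g])
  then have "cycle_type {1..n} x = cycle_type {1..n} p"
    by (simp only: permutes_image[OF g])
  moreover have "x permutes {1..n}"
    unfolding x by (intro permutes_compose permutes_inv g p)
  ultimately show "x permutes {1..n} \<and> cycle_type {1..n} x = cycle_type {1..n} p" by simp
next
  assume "x permutes {1..n} \<and> cycle_type {1..n} x = cycle_type {1..n} p"
  then have x: "x permutes {1..n}" and eq: "cycle_type {1..n} p = cycle_type {1..n} x" by simp_all
  obtain h where h: "bij_betw h {1..n} {1..n}" and hp: "\<forall>z\<in>{1..n}. h (p z) = x (h z)"
    by (rule same_cycle_type_conj[OF permutes_perm_on[OF finite_atLeastAtMost p]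
          permutes_perm_on[OF finite_atLeastAtMost x] eq])
  define g where "g = (\<lambda>z. if z \<in> {1..n} then h z else z)"
  have g: "g permutes {1..n}"
  proof (rule bij_imp_permutes)
    show "bij_betw g {1..n} {1..n}"
      using h by (rule bij_betw_cong[THEN iffD1, rotated]) (simp add: g_def)
  qed (auto simp: g_def)
  have "g (p z) = x (g z)" for z
  proof (cases "z \<in> {1..n}")
    case True
    moreover then have "p z \<in> {1..n}" by (simp only: permutes_in_image[OF p])
    ultimately show ?thesis using bspec[OF hp True] by (simp only: g_def if_True)
  next
    case False
    then show ?thesis
      using permutes_not_in[OF p False] permutes_not_in[OF x False] by (simp only: g_def if_False)
  qed
  then have "g \<circ> p = x \<circ> g" by auto
  then have "x = g \<circ> p \<circ> inv' g"
    by (simp add: comp_assoc permutes_inv_o(1)[OF g])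
  moreover have g': "g \<in> carrier (sym_group n)"
    by (simp only: sym_group_carrier g)
  ultimately have "x = g \<otimes>\<^bsub>sym_group n\<^esub> p \<otimes>\<^bsub>sym_group n\<^esub> inv\<^bsub>sym_group n\<^esub> g"
    by (simp only: sym_group_mult sym_group_inv_equality)
  with g' show "x \<in> conjugates (sym_group n) p"
    unfolding conjugates_def by blast
qed

text \<open>For the backward direction, a commuting pair \<open>P\<close>, \<open>Q\<close> on some set with the right cycle types is
transported to \<open>{1..n}\<close> by a bijection \<open>h\<close> that turns \<open>P\<close> into \<open>p\<close> itself. It then turns \<open>Q\<close> into some
\<open>y\<close> that commutes with \<open>p\<close> and is conjugate to \<open>q\<close>.\<close>
lemma have_commuting_conjugates_iff_commuting_types:
  assumes p: "p permutes {1..n}" and q: "q permutes {1..n}"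
  shows "have_commuting_conjugates (sym_group n) p q
    \<longleftrightarrow> commuting_types (cycle_type {1..n} p) (cycle_type {1..n} q)"
proof
  assume "have_commuting_conjugates (sym_group n) p q"
  then obtain x y where x: "x permutes {1..n}" "cycle_type {1..n} x = cycle_type {1..n} p"
    and y: "y permutes {1..n}" "cycle_type {1..n} y = cycle_type {1..n} q" and "x \<circ> y = y \<circ> x"
    unfolding have_commuting_conjugates_def Bex_def conjugates_sym_group_iff[OF p]
      conjugates_sym_group_iff[OF q] sym_group_mult by blast
  then have "x (y z) = y (x z)" for z by (metis o_apply)
  then show "commuting_types (cycle_type {1..n} p) (cycle_type {1..n} q)"
    using commuting_typesI[OF permutes_perm_on[OF _ x(1)] permutes_perm_on[OF _ y(1)]]
    by (simp only: x(2) y(2) finite_atLeastAtMost)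
next
  assume "commuting_types (cycle_type {1..n} p) (cycle_type {1..n} q)"
  then obtain A :: "nat set" and P Q where P: "perm_on A P" and Q: "perm_on A Q"
    and comm: "\<forall>x\<in>A. P (Q x) = Q (P x)"
    and cP: "cycle_type A P = cycle_type {1..n} p" and cQ: "cycle_type A Q = cycle_type {1..n} q"
    by (rule commuting_typesE)
  have pp: "perm_on {1..n} p" using p by (simp add: permutes_perm_on)
  obtain h where h: "bij_betw h {1..n} A" and hp: "\<forall>z\<in>{1..n}. h (p z) = P (h z)"
    by (rule same_cycle_type_conj[OF pp P cP[symmetric]])
  have hA: "h z \<in> A" if "z \<in> {1..n}" for z using h that by (rule bij_betwE[THEN bspec])
  define k where "k = the_inv_into {1..n} h"
  have k: "bij_betw k A {1..n}" unfolding k_def by (rule bij_betw_the_inv_into[OF h])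
  have hk: "h (k x) = x" if "x \<in> A" for x
    unfolding k_def using h that by (intro f_the_inv_into_f_bij_betw) auto
  define y where "y = (\<lambda>z. if z \<in> {1..n} then k (Q (h z)) else z)"
  have hy: "h (y z) = Q (h z)" if "z \<in> {1..n}" for z
    using hk[OF perm_on_in[OF Q hA[OF that]]] that by (simp only: y_def if_True)
  have "bij_betw (k \<circ> Q \<circ> h) {1..n} {1..n}"
    by (intro bij_betw_trans[OF h] bij_betw_trans[OF perm_on_bij[OF Q]] k)
  then have "bij_betw y {1..n} {1..n}"
    by (rule bij_betw_cong[THEN iffD1, rotated]) (simp add: y_def)
  then have y: "y permutes {1..n}"
    by (rule bij_imp_permutes) (auto simp: y_def)
  have "cycle_type (h ` {1..n}) Q = cycle_type {1..n} y"
    by (rule cycle_type_conj[OF permutes_perm_on[OF _ y] bij_betw_imp_inj_on[OF h] hy]) simp_all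
  then have cy: "cycle_type {1..n} y = cycle_type {1..n} q"
    unfolding bij_betw_imp_surj_on[OF h] cQ by (rule sym)
  have "p (y z) = y (p z)" for z
  proof (cases "z \<in> {1..n}")
    case True
    then have yz: "y z \<in> {1..n}" and pz: "p z \<in> {1..n}"
      by (simp_all only: permutes_in_image[OF y] permutes_in_image[OF p])
    have "h (p (y z)) = P (Q (h z))" by (simp only: bspec[OF hp yz] hy[OF True])
    also have "\<dots> = Q (P (h z))" by (rule bspec[OF comm hA[OF True]])
    also have "\<dots> = h (y (p z))" by (simp only: bspec[OF hp True] hy[OF pz])
    finally have "h (p (y z)) = h (y (p z))" .
    then show ?thesis
      by (rule inj_onD[OF bij_betw_imp_inj_on[OF h]])
         (simp_all only: permutes_in_image[OF y] permutes_in_image[OF p] True)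
  next
    case False
    then show ?thesis by (simp only: permutes_not_in[OF p False] permutes_not_in[OF y False])
  qed
  then have "p \<circ> y = y \<circ> p" by auto
  then show "have_commuting_conjugates (sym_group n) p q"
    unfolding have_commuting_conjugates_def sym_group_mult
    using conjugates_sym_group_iff[OF p, of p] conjugates_sym_group_iff[OF q, of y] p y cy by blast
qed

lemma pair_pmf_of_set:
  assumes "finite A" "A \<noteq> {}" "finite B" "B \<noteq> {}"
  shows "pair_pmf (pmf_of_set A) (pmf_of_set B) = pmf_of_set (A \<times> B)"
proof (rule pmf_eqI)
  fix x :: "'a \<times> 'b"
  show "pmf (pair_pmf (pmf_of_set A) (pmf_of_set B)) x = pmf (pmf_of_set (A \<times> B)) x"
    using assms by (cases x) (simp add: pmf_pair card_cartesian_product indicator_def)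
qed

lemma rho_sym_group:
  "rho (sym_group n) = (\<Sum>M\<in>partitions n. \<Sum>N\<in>partitions n.
     weight M * weight N * of_bool (commuting_types M N))"
proof -
  let ?S = "{p. p permutes {1..n}}"
  let ?c = "have_commuting_conjugates (sym_group n)"
  let ?C = "\<lambda>M N. of_bool (commuting_types M N) :: real"
  have fin: "finite ?S" by (rule finite_permutations) simp
  have ne: "?S \<noteq> {}" using permutes_id by blast
  have card: "card ?S = fact n" by (rule card_permutations) auto
  have carrier: "carrier (sym_group n) = ?S" by (simp add: sym_group_def)
  have "rho (sym_group n) = measure_pmf.prob (pmf_of_set (?S \<times> ?S)) {(x, y). ?c x y}"
    unfolding rho_def carrier by (simp only: pair_pmf_of_set[OF fin ne fin ne])
  also have "\<dots> = card ((?S \<times> ?S) \<inter> {(x, y). ?c x y}) / card (?S \<times> ?S)"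
    using fin ne by (intro measure_pmf_of_set) auto
  also have "real (card ((?S \<times> ?S) \<inter> {(x, y). ?c x y})) = (\<Sum>(x,y)\<in>?S \<times> ?S. of_bool (?c x y))"
    using fin by (simp add: case_prod_beta sum_of_bool_eq Int_def)
  also have "\<dots> = (\<Sum>x\<in>?S. \<Sum>y\<in>?S. of_bool (?c x y))"
    by (rule sum.cartesian_product[symmetric])
  also have "\<dots> = (\<Sum>x\<in>?S. \<Sum>y\<in>?S. ?C (cycle_type {1..n} x) (cycle_type {1..n} y))"
    by (intro sum.cong refl) (simp add: have_commuting_conjugates_iff_commuting_types)
  also have "\<dots> = (\<Sum>x\<in>?S. fact n * (\<Sum>N\<in>partitions n. weight N * ?C (cycle_type {1..n} x) N))"
  proof (intro sum.cong refl)
    fix x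
    show "(\<Sum>y\<in>?S. ?C (cycle_type {1..n} x) (cycle_type {1..n} y))
        = fact n * (\<Sum>N\<in>partitions n. weight N * ?C (cycle_type {1..n} x) N)"
      using sum_over_cycle_types[of "{1..n}" "?C (cycle_type {1..n} x)"]
      by (simp only: finite_atLeastAtMost card_atLeastAtMost) simp
  qed
  also have "\<dots> = fact n * (\<Sum>M\<in>partitions n. weight M * (fact n * (\<Sum>N\<in>partitions n. weight N * ?C M N)))"
    using sum_over_cycle_types[of "{1..n}" "\<lambda>M. fact n * (\<Sum>N\<in>partitions n. weight N * ?C M N)"] by simp
  also have "\<dots> = fact n * fact n * (\<Sum>M\<in>partitions n. \<Sum>N\<in>partitions n. weight M * weight N * ?C M N)"
    by (simp only: sum_distrib_left mult.assoc mult.left_commute)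
  also have "real (card (?S \<times> ?S)) = fact n * fact n"
    by (simp only: card_cartesian_product card of_nat_mult of_nat_fact)
  finally show ?thesis by simp
qed

section \<open>Removing an orbit of a commuting pair\<close>

lemma sum_over_containing:
  assumes U: "U \<in> partitions m" and m: "m \<le> n"
  shows "(\<Sum>M\<in>partitions n. if U \<subseteq># M then f M (M - U) else 0) = (\<Sum>L\<in>partitions (n - m). f (U + L) L :: real)"
proof -
  have sum_U: "sum_mset U = m" using U by (simp add: partitions_def)
  have "(\<Sum>M\<in>partitions n. if U \<subseteq># M then f M (M - U) else 0)
      = (\<Sum>M | M \<in> partitions n \<and> U \<subseteq># M. f M (M - U))"
    by (rule sum.mono_neutral_cong_right) auto
  also have "\<dots> = (\<Sum>L\<in>partitions (n - m). f (U + L) L)"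
  proof (rule sum.reindex_bij_witness[where i = "\<lambda>L. U + L" and j = "\<lambda>M. M - U"])
    fix M assume M: "M \<in> {M. M \<in> partitions n \<and> U \<subseteq># M}"
    then show "U + (M - U) = M" by simp
    then show "f (U + (M - U)) (M - U) = f M (M - U)" by simp
    show "M - U \<in> partitions (n - m)"
      using M partitions_diff[of M n U] by (simp add: sum_U)
  next
    fix L assume L: "L \<in> partitions (n - m)"
    show "U + L - U = L" by simp
    show "U + L \<in> {M. M \<in> partitions n \<and> U \<subseteq># M}"
      using partitions_add[OF U L] m by simp
  qed
  finally show ?thesis .
qed

text \<open>By symmetry it does not matter which of the two permutations has the long cycle.\<close>
lemma commuting_types_remove_rect:
  assumes "commuting_types M N" "k \<in># M \<or> k \<in># N"
  obtains m U V where "k \<le> m" "U \<in> rect_partitions m" "V \<in> rect_partitions m"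
    "U \<subseteq># M" "V \<subseteq># N" "commuting_types (M - U) (N - V)"
proof -
  have *: "\<exists>m U V. k \<le> m \<and> U \<in> rect_partitions m \<and> V \<in> rect_partitions m \<and>
      U \<subseteq># M \<and> V \<subseteq># N \<and> commuting_types (M - U) (N - V)"
    if MN: "commuting_types M N" and k: "k \<in># M" for M N
  proof -
    obtain c d b where c: "c > 0" "d > 0" "b > 0" "k > 0" "c * k = d * b"
      and UV: "replicate_mset c k \<subseteq># M" "replicate_mset d b \<subseteq># N"
        "commuting_types (M - replicate_mset c k) (N - replicate_mset d b)"
      by (rule commuting_types_split[OF MN k])
    have "replicate_mset c k \<in> rect_partitions (c * k)" "replicate_mset d b \<in> rect_partitions (c * k)"
      using c by (auto simp: rect_partitions_def partitions_def)
    moreover have "k \<le> c * k" using c(1) by (cases c) simp_all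
    ultimately show ?thesis using UV by blast
  qed
  show ?thesis
  proof (cases "k \<in># M")
    case True
    then show ?thesis using *[OF assms(1) True] that by blast
  next
    case False
    then have "k \<in># N" using assms(2) by simp
    from *[OF commuting_types_sym[OF assms(1)] this]
    show ?thesis using that commuting_types_sym by blast
  qed
qed

text \<open>This is \<open>rho (sym_group n)\<close>, by \<open>rho_sym_group\<close>.\<close>
definition commuting_weight :: "nat \<Rightarrow> real" where
  "commuting_weight n = (\<Sum>M\<in>partitions n. \<Sum>N\<in>partitions n.
     weight M * weight N * of_bool (commuting_types M N))"

lemma sum_over_containing_pair:
  assumes U: "U \<in> partitions m" and V: "V \<in> partitions m" and m: "m \<le> n"
  shows "(\<Sum>M\<in>partitions n. \<Sum>N\<in>partitions n. weight M * weight N *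
      of_bool (U \<subseteq># M \<and> V \<subseteq># N \<and> commuting_types (M - U) (N - V)))
    = (\<Sum>L\<in>partitions (n - m). \<Sum>K\<in>partitions (n - m).
        weight (U + L) * weight (V + K) * of_bool (commuting_types L K))"
proof -
  have "(\<Sum>M\<in>partitions n. \<Sum>N\<in>partitions n. weight M * weight N *
      of_bool (U \<subseteq># M \<and> V \<subseteq># N \<and> commuting_types (M - U) (N - V)))
      = (\<Sum>M\<in>partitions n. if U \<subseteq># M then \<Sum>N\<in>partitions n. if V \<subseteq># N
           then weight M * weight N * of_bool (commuting_types (M - U) (N - V)) else 0 else 0)"
  proof (rule sum.cong[OF refl])
    fix M
    show "(\<Sum>N\<in>partitions n. weight M * weight N *
        of_bool (U \<subseteq># M \<and> V \<subseteq># N \<and> commuting_types (M - U) (N - V)))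
      = (if U \<subseteq># M then \<Sum>N\<in>partitions n. if V \<subseteq># N
           then weight M * weight N * of_bool (commuting_types (M - U) (N - V)) else 0 else 0)"
    proof (cases "U \<subseteq># M")
      case True
      show ?thesis unfolding if_P[OF True] by (rule sum.cong[OF refl]) (simp add: True)
    next
      case False
      show ?thesis unfolding if_not_P[OF False] by (rule sum.neutral) (simp add: False)
    qed
  qed
  also have "\<dots> = (\<Sum>L\<in>partitions (n - m). \<Sum>K\<in>partitions (n - m).
      weight (U + L) * weight (V + K) * of_bool (commuting_types L K))"
    unfolding sum_over_containing[OF U m, where f = "\<lambda>M L. \<Sum>N\<in>partitions n. if V \<subseteq># N
           then weight M * weight N * of_bool (commuting_types L (N - V)) else 0"]
    by (intro sum.cong refl sum_over_containing[OF V m])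
  finally show ?thesis .
qed

lemma sum_over_containing_pair_le:
  assumes U: "U \<in> partitions m" and V: "V \<in> partitions m" and m: "m \<le> n"
  shows "(\<Sum>M\<in>partitions n. \<Sum>N\<in>partitions n. weight M * weight N *
      of_bool (U \<subseteq># M \<and> V \<subseteq># N \<and> commuting_types (M - U) (N - V)))
    \<le> weight U * weight V * commuting_weight (n - m)"
proof -
  have "(\<Sum>L\<in>partitions (n - m). \<Sum>K\<in>partitions (n - m).
      weight (U + L) * weight (V + K) * of_bool (commuting_types L K)) \<le> (\<Sum>L\<in>partitions (n - m). \<Sum>K\<in>partitions (n - m).
      weight U * weight V * (weight L * weight K * of_bool (commuting_types L K)))"
  proof (intro sum_mono)
    fix L K
    have "weight (U + L) * weight (V + K) \<le> (weight U * weight L) * (weight V * weight K)"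
      by (intro mult_mono weight_add_le mult_nonneg_nonneg weight_nonneg)
    then have "weight (U + L) * weight (V + K) * of_bool (commuting_types L K)
       \<le> (weight U * weight L) * (weight V * weight K) * of_bool (commuting_types L K)"
      by (rule mult_right_mono) simp
    then show "weight (U + L) * weight (V + K) * of_bool (commuting_types L K)
       \<le> weight U * weight V * (weight L * weight K * of_bool (commuting_types L K))"
      by (simp only: mult_ac)
  qed
  also have "\<dots> = weight U * weight V * commuting_weight (n - m)"
    by (simp only: commuting_weight_def sum_distrib_left)
  finally show ?thesis unfolding sum_over_containing_pair[OF assms] .
qed

lemma commuting_weight_nonneg: "commuting_weight n \<ge> 0"
  unfolding commuting_weight_def by (intro sum_nonneg mult_nonneg_nonneg weight_nonneg) simp

text \<open>A commuting pair of types either has no part exceeding \<open>r\<close> on either side or loses rectangular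
partitions \<open>U\<close>, \<open>V\<close> of a common \<open>m > r\<close>. The second alternative is estimated by a union bound over
\<open>m\<close>, \<open>U\<close> and \<open>V\<close>.\<close>
lemma commuting_weight_upper:
  assumes "r > 0"
  shows "commuting_weight n \<le> (1 / fact (n div r))\<^sup>2
    + (\<Sum>m\<in>{r<..n}. (1 / real m + 8 / (real m)\<^sup>2)\<^sup>2 * commuting_weight (n - m))"
proof -
  let ?s = "\<lambda>M. of_bool (\<forall>k\<in>#M. k \<le> r) :: real"
  let ?e = "\<lambda>M N U V. of_bool (U \<subseteq># M \<and> V \<subseteq># N \<and> commuting_types (M - U) (N - V)) :: real"
  let ?R = rect_partitions
  let ?P = "partitions n"
  have ind: "of_bool (commuting_types M N)
      \<le> ?s M * ?s N + (\<Sum>m\<in>{r<..n}. \<Sum>U\<in>?R m. \<Sum>V\<in>?R m. ?e M N U V)"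
    if M: "M \<in> ?P" for M N
  proof (cases "commuting_types M N \<and> (\<exists>k. (k \<in># M \<or> k \<in># N) \<and> k > r)")
    case True
    then obtain k where c: "commuting_types M N" and k: "k \<in># M \<or> k \<in># N" "k > r" by blast
    obtain m U V where m: "k \<le> m" and U: "U \<in> ?R m" and V: "V \<in> ?R m" and
      sub: "U \<subseteq># M" "V \<subseteq># N" "commuting_types (M - U) (N - V)"
      by (rule commuting_types_remove_rect[OF c k(1)])
    have "sum_mset M = sum_mset U + sum_mset (M - U)"
      using sub(1) by (metis subset_mset.add_diff_inverse sum_mset.union)
    then have "m \<le> n" using M U by (simp add: partitions_def rect_partitions_def)
    then have mem: "m \<in> {r<..n}" using m k(2) by simp
    have "1 = ?e M N U V" using sub by simp
    also have "\<dots> \<le> (\<Sum>V\<in>?R m. ?e M N U V)"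
      by (rule member_le_sum[OF V]) simp_all
    also have "\<dots> \<le> (\<Sum>U\<in>?R m. \<Sum>V\<in>?R m. ?e M N U V)"
      by (rule member_le_sum[OF U]) (simp_all add: sum_nonneg)
    also have "\<dots> \<le> (\<Sum>m\<in>{r<..n}. \<Sum>U\<in>?R m. \<Sum>V\<in>?R m. ?e M N U V)"
      by (rule member_le_sum[OF mem, of "\<lambda>m. \<Sum>U\<in>?R m. \<Sum>V\<in>?R m. ?e M N U V"])
         (simp_all add: sum_nonneg)
    finally have "1 \<le> (\<Sum>m\<in>{r<..n}. \<Sum>U\<in>?R m. \<Sum>V\<in>?R m. ?e M N U V)" .
    moreover have "0 \<le> ?s M * ?s N" by simp
    moreover have "of_bool (commuting_types M N) \<le> (1 :: real)" by simp
    ultimately show ?thesis by linarith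
  next
    case False
    have "0 \<le> (\<Sum>m\<in>{r<..n}. \<Sum>U\<in>?R m. \<Sum>V\<in>?R m. ?e M N U V)"
      by (intro sum_nonneg) simp
    moreover have "of_bool (commuting_types M N) \<le> ?s M * ?s N"
      using False by (cases "commuting_types M N") (auto simp: not_less)
    ultimately show ?thesis by linarith
  qed
  have "commuting_weight n \<le> (\<Sum>M\<in>?P. \<Sum>N\<in>?P. weight M * weight N *
      (?s M * ?s N + (\<Sum>m\<in>{r<..n}. \<Sum>U\<in>?R m. \<Sum>V\<in>?R m. ?e M N U V)))"
    unfolding commuting_weight_def
    by (intro sum_mono mult_left_mono ind mult_nonneg_nonneg weight_nonneg)
  also have "\<dots> = (\<Sum>M\<in>?P. \<Sum>N\<in>?P. (weight M * ?s M) * (weight N * ?s N))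
      + (\<Sum>M\<in>?P. \<Sum>N\<in>?P. \<Sum>m\<in>{r<..n}. \<Sum>U\<in>?R m. \<Sum>V\<in>?R m. weight M * weight N * ?e M N U V)"
    by (simp only: distrib_left sum.distrib sum_distrib_left mult_ac)
  also have "(\<Sum>M\<in>?P. \<Sum>N\<in>?P. (weight M * ?s M) * (weight N * ?s N)) = (small_parts_weight r n)\<^sup>2"
  proof -
    have "small_parts_weight r n = (\<Sum>M\<in>?P. weight M * ?s M)"
      unfolding small_parts_weight_def by (rule sum.mono_neutral_cong_left) auto
    then show ?thesis by (simp only: power2_eq_square sum_product)
  qed
  also have "\<dots> \<le> (1 / fact (n div r))\<^sup>2"
  proof (rule power_mono[OF small_parts_weight_le[OF assms]])
    show "0 \<le> small_parts_weight r n" unfolding small_parts_weight_def by (intro sum_nonneg) simp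
  qed
  also have "(\<Sum>M\<in>?P. \<Sum>N\<in>?P. \<Sum>m\<in>{r<..n}. \<Sum>U\<in>?R m. \<Sum>V\<in>?R m. weight M * weight N * ?e M N U V)
      = (\<Sum>m\<in>{r<..n}. \<Sum>U\<in>?R m. \<Sum>V\<in>?R m. \<Sum>M\<in>?P. \<Sum>N\<in>?P. weight M * weight N * ?e M N U V)"
  proof -
    have "(\<Sum>M\<in>?P. \<Sum>N\<in>?P. \<Sum>m\<in>{r<..n}. \<Sum>U\<in>?R m. \<Sum>V\<in>?R m. weight M * weight N * ?e M N U V)
      = (\<Sum>M\<in>?P. \<Sum>m\<in>{r<..n}. \<Sum>N\<in>?P. \<Sum>U\<in>?R m. \<Sum>V\<in>?R m. weight M * weight N * ?e M N U V)"
      by (intro sum.cong refl sum.swap)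
    also have "\<dots> = (\<Sum>m\<in>{r<..n}. \<Sum>M\<in>?P. \<Sum>N\<in>?P. \<Sum>U\<in>?R m. \<Sum>V\<in>?R m. weight M * weight N * ?e M N U V)"
      by (rule sum.swap)
    also have "\<dots> = (\<Sum>m\<in>{r<..n}. \<Sum>M\<in>?P. \<Sum>U\<in>?R m. \<Sum>N\<in>?P. \<Sum>V\<in>?R m. weight M * weight N * ?e M N U V)"
      by (intro sum.cong refl sum.swap)
    also have "\<dots> = (\<Sum>m\<in>{r<..n}. \<Sum>U\<in>?R m. \<Sum>M\<in>?P. \<Sum>N\<in>?P. \<Sum>V\<in>?R m. weight M * weight N * ?e M N U V)"
      by (intro sum.cong[OF refl] sum.swap)
    also have "\<dots> = (\<Sum>m\<in>{r<..n}. \<Sum>U\<in>?R m. \<Sum>M\<in>?P. \<Sum>V\<in>?R m. \<Sum>N\<in>?P. weight M * weight N * ?e M N U V)"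
      by (intro sum.cong refl sum.swap)
    also have "\<dots> = (\<Sum>m\<in>{r<..n}. \<Sum>U\<in>?R m. \<Sum>V\<in>?R m. \<Sum>M\<in>?P. \<Sum>N\<in>?P. weight M * weight N * ?e M N U V)"
      by (rule sum.cong[OF refl], rule sum.cong[OF refl], rule sum.swap)
    finally show ?thesis .
  qed
  also have "\<dots> \<le> (\<Sum>m\<in>{r<..n}. (1 / real m + 8 / (real m)\<^sup>2)\<^sup>2 * commuting_weight (n - m))"
  proof (rule sum_mono)
    fix m assume m: "m \<in> {r<..n}"
    have "(\<Sum>U\<in>?R m. \<Sum>V\<in>?R m. \<Sum>M\<in>?P. \<Sum>N\<in>?P. weight M * weight N * ?e M N U V)
        \<le> (\<Sum>U\<in>?R m. \<Sum>V\<in>?R m. weight U * weight V * commuting_weight (n - m))"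
      using m by (intro sum_mono sum_over_containing_pair_le) (auto simp: rect_partitions_def)
    also have "\<dots> = (rect_weight m)\<^sup>2 * commuting_weight (n - m)"
    proof -
      have "(rect_weight m)\<^sup>2 = (\<Sum>U\<in>?R m. \<Sum>V\<in>?R m. weight U * weight V)"
        by (simp only: rect_weight_def power2_eq_square sum_product)
      then show ?thesis by (simp only: sum_distrib_right)
    qed
    also have "\<dots> \<le> (1 / real m + 8 / (real m)\<^sup>2)\<^sup>2 * commuting_weight (n - m)"
    proof (rule mult_right_mono[OF power_mono commuting_weight_nonneg])
      show "rect_weight m \<le> 1 / real m + 8 / (real m)\<^sup>2"
        using m by (intro rect_weight_le) simp
      show "0 \<le> rect_weight m" unfolding rect_weight_def by (intro sum_nonneg) simp
    qed
    finally show "(\<Sum>U\<in>?R m. \<Sum>V\<in>?R m. \<Sum>M\<in>?P. \<Sum>N\<in>?P. weight M * weight N * ?e M N U V)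
        \<le> (1 / real m + 8 / (real m)\<^sup>2)\<^sup>2 * commuting_weight (n - m)" .
  qed
  finally show ?thesis by simp
qed

lemma long_part_unique:
  assumes M: "M \<in> partitions n" and "k \<in># M" "l \<in># M" "n div 2 < k" "n div 2 < l"
  shows "k = l"
proof (rule ccontr)
  assume "k \<noteq> l"
  then have "l \<in># M - {#k#}" using assms(3) by (simp add: in_diff_count)
  then have "k + l \<le> sum_mset M"
    using sum_mset.remove[of l "M - {#k#}"] sum_mset.remove[OF assms(2)] by simp
  then show False using assms by (simp add: partitions_def)
qed

text \<open>Adding a part \<open>k > n/2\<close> to two commuting types of \<open>n - k\<close> gives commuting types of \<open>n\<close>. The part is new
on both sides, so the weights are divided by exactly \<open>k\<close>, and since a partition of \<open>n\<close> has at most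
one part exceeding \<open>n/2\<close>, no pair is obtained twice.\<close>
lemma commuting_weight_lower:
  "(\<Sum>k\<in>{n div 2<..n}. commuting_weight (n - k) / (real k)\<^sup>2) \<le> commuting_weight n"
proof -
  let ?P = "partitions n"
  let ?K = "{n div 2<..n}"
  let ?e = "\<lambda>M N k. of_bool ({#k#} \<subseteq># M \<and> {#k#} \<subseteq># N \<and> commuting_types (M - {#k#}) (N - {#k#})) :: real"
  have "(\<Sum>k\<in>?K. commuting_weight (n - k) / (real k)\<^sup>2)
      = (\<Sum>k\<in>?K. \<Sum>M\<in>?P. \<Sum>N\<in>?P. weight M * weight N * ?e M N k)"
  proof (rule sum.cong[OF refl])
    fix k assume k: "k \<in> ?K"
    then have U: "{#k#} \<in> partitions k" and kn: "k \<le> n" "k > 0" by (auto simp: partitions_def)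
    have new: "weight ({#k#} + L) = weight L / k" if "L \<in> partitions (n - k)" for L
    proof -
      have "k \<notin># L" using partitions_le[OF that, of k] k by auto
      then show ?thesis using kn by (simp add: weight_add_new)
    qed
    have "(\<Sum>M\<in>?P. \<Sum>N\<in>?P. weight M * weight N * ?e M N k)
      = (\<Sum>L\<in>partitions (n - k). \<Sum>K\<in>partitions (n - k).
        weight ({#k#} + L) * weight ({#k#} + K) * of_bool (commuting_types L K))"
      by (rule sum_over_containing_pair[OF U U kn(1)])
    also have "\<dots> = (\<Sum>L\<in>partitions (n - k). \<Sum>K\<in>partitions (n - k).
        weight L * weight K * of_bool (commuting_types L K) / (real k)\<^sup>2)"
      by (intro sum.cong refl) (simp only: new power2_eq_square times_divide_eq_left times_divide_eq_right divide_divide_eq_left)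
    also have "\<dots> = commuting_weight (n - k) / (real k)\<^sup>2"
      by (simp only: commuting_weight_def sum_divide_distrib)
    finally show "commuting_weight (n - k) / (real k)\<^sup>2 = (\<Sum>M\<in>?P. \<Sum>N\<in>?P. weight M * weight N * ?e M N k)" ..
  qed
  also have "\<dots> = (\<Sum>M\<in>?P. \<Sum>k\<in>?K. \<Sum>N\<in>?P. weight M * weight N * ?e M N k)"
    by (rule sum.swap)
  also have "\<dots> = (\<Sum>M\<in>?P. \<Sum>N\<in>?P. \<Sum>k\<in>?K. weight M * weight N * ?e M N k)"
    by (rule sum.cong[OF refl], rule sum.swap)
  also have "\<dots> = (\<Sum>M\<in>?P. \<Sum>N\<in>?P. weight M * weight N * (\<Sum>k\<in>?K. ?e M N k))"
    by (simp only: sum_distrib_left)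
  also have "\<dots> \<le> commuting_weight n"
    unfolding commuting_weight_def
  proof (intro sum_mono mult_left_mono mult_nonneg_nonneg weight_nonneg)
    fix M N assume M: "M \<in> ?P"
    show "(\<Sum>k\<in>?K. ?e M N k) \<le> of_bool (commuting_types M N)"
    proof (cases "\<exists>l\<in>?K. ?e M N l \<noteq> 0")
      case True
      then obtain l where l: "l \<in> ?K" "?e M N l \<noteq> 0" by blast
      then have lM: "l \<in># M" "l \<in># N" and c: "commuting_types (M - {#l#}) (N - {#l#})"
        by (simp_all split: if_splits)
      have "?e M N k = 0" if "k \<in> ?K - {l}" for k
        using long_part_unique[OF M, of k l] lM l(1) that by auto
      then have "(\<Sum>k\<in>?K. ?e M N k) = (\<Sum>k\<in>{l}. ?e M N k)"
        using l(1) by (intro sum.mono_neutral_right) auto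
      also have "\<dots> = ?e M N l"
        by (simp only: sum.insert finite.emptyI empty_iff not_False_eq_True sum.empty add_0_right)
      also have "\<dots> \<le> 1" by simp
      also have "commuting_types (add_mset l (M - {#l#})) (add_mset l (N - {#l#}))"
        using l(1) by (intro commuting_types_add_mset c) auto
      then have "(1 :: real) = of_bool (commuting_types M N)" using lM by simp
      finally show ?thesis .
    next
      case False
      then have "(\<Sum>k\<in>?K. ?e M N k) = 0" by (intro sum.neutral) blast
      then show ?thesis by simp
    qed
  qed
  finally show ?thesis .
qed


section \<open>Asymptotics of sequences satisfying the two inequalities\<close>

text \<open>Telescoping, from \<open>1 / (n + 1)\<^sup>2 \<le> 1 / n - 1 / (n + 1)\<close>.\<close>
lemma sum_inverse_squares_tail_le:
  assumes "r > 0"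
  shows "(\<Sum>m\<in>{r<..n}. 1 / (real m)\<^sup>2) \<le> 1 / r"
proof -
  have "(\<Sum>m\<in>{r<..n}. 1 / (real m)\<^sup>2) \<le> 1 / r - 1 / n" if "r \<le> n"
    using that
  proof (induction n rule: dec_induct)
    case (step n)
    have "{r<..Suc n} = insert (Suc n) {r<..n}" using step(1) by auto
    moreover have "1 / (real (Suc n))\<^sup>2 \<le> 1 / n - 1 / Suc n"
    proof -
      have "n > 0" using step(1) assms by simp
      then have "1 / real n - 1 / Suc n = 1 / (real n * real (Suc n))"
        by (simp add: field_simps)
      moreover have "1 / (real (Suc n))\<^sup>2 \<le> 1 / (real n * real (Suc n))"
        unfolding power2_eq_square using \<open>n > 0\<close> by (intro divide_left_mono mult_right_mono) auto
      ultimately show ?thesis by simp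
    qed
    ultimately show ?case using step.IH by simp
  qed simp
  moreover have "1 / real n \<ge> 0" by simp
  ultimately show ?thesis
    by (cases "r \<le> n") (auto intro: order_trans)
qed

lemma sum_reflect_upper_half:
  "(\<Sum>k\<in>{n div 2<..n}. f k) = (\<Sum>j<n - n div 2. f (n - j))" for n :: nat
  by (rule sum.reindex_bij_witness[where i = "\<lambda>j. n - j" and j = "\<lambda>k. n - k"]) auto

lemma filterlim_floor_sqrt: "filterlim floor_sqrt at_top sequentially"
  unfolding filterlim_at_top
proof
  fix r
  show "\<forall>\<^sub>F n in sequentially. r \<le> floor_sqrt n"
    using eventually_ge_at_top[of "r\<^sup>2"]
    by eventually_elim (metis floor_sqrt_inverse_power2 mono_floor_sqrt')
qed

text \<open>With \<open>r\<close> the integer part of the square root of \<open>n\<close>, the quotient \<open>n div r\<close> is at least \<open>r\<close> while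
\<open>n < (r + 1)\<^sup>2\<close>, so it suffices that \<open>(r + 1)\<^sup>2 / r!\<close> tends to \<open>0\<close>.\<close>
lemma square_div_fact_floor_sqrt_tendsto_0:
  "(\<lambda>n. (real n / fact (n div floor_sqrt n))\<^sup>2) \<longlonglongrightarrow> 0"
proof -
  let ?g = "\<lambda>r. (real r + 1)\<^sup>2 / fact r"
  have g: "?g \<longlonglongrightarrow> 0"
  proof (rule LIMSEQ_offset[of _ 3])
    show "(\<lambda>k. ?g (k + 3)) \<longlonglongrightarrow> 0"
    proof (rule tendsto_sandwich[where f = "\<lambda>_. 0" and h = "\<lambda>k. (real k + 4)\<^sup>2 / ((real k + 3) * (real k + 2) * (real k + 1))"])
      show "\<forall>\<^sub>F k in sequentially. ?g (k + 3) \<le> (real k + 4)\<^sup>2 / ((real k + 3) * (real k + 2) * (real k + 1))"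
      proof (intro always_eventually allI)
        fix k
        have eq: "fact (k + 3) = (real k + 3) * (real k + 2) * (real k + 1) * fact k"
          by (simp add: numeral_3_eq_3 algebra_simps)
        have "((real k + 3) * (real k + 2) * (real k + 1)) * 1 \<le> fact (k + 3)"
          unfolding eq by (rule mult_left_mono) auto
        then show "?g (k + 3) \<le> (real k + 4)\<^sup>2 / ((real k + 3) * (real k + 2) * (real k + 1))"
          by (intro frac_le) (auto simp: add.commute)
      qed
      show "(\<lambda>k. (real k + 4)\<^sup>2 / ((real k + 3) * (real k + 2) * (real k + 1))) \<longlonglongrightarrow> 0"
        by real_asymp
    qed auto
  qed
  have "(\<lambda>n. real n / fact (n div floor_sqrt n)) \<longlonglongrightarrow> 0"
  proof (rule tendsto_sandwich[OF _ _ tendsto_const filterlim_compose[OF g filterlim_floor_sqrt]])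
    show "\<forall>\<^sub>F n in sequentially. real n / fact (n div floor_sqrt n) \<le> ?g (floor_sqrt n)"
      using eventually_gt_at_top[of 0]
    proof eventually_elim
      case (elim n)
      define r where "r = floor_sqrt n"
      have r: "r > 0" "r * r \<le> n" "n \<le> (r + 1)\<^sup>2"
        using elim Suc_floor_sqrt_power2_gt[of n] floor_sqrt_power2_le[of n]
        by (auto simp: r_def power2_eq_square)
      have "r \<le> n div r" using r by (simp add: less_eq_div_iff_mult_less_eq)
      then have "(fact r :: real) \<le> fact (n div r)" by (rule fact_mono)
      moreover have "real n \<le> (real r + 1)\<^sup>2"
        using r(3) by (metis of_nat_1 of_nat_add of_nat_le_iff of_nat_power)
      ultimately show ?case unfolding r_def[symmetric] by (intro frac_le) auto
    qed
  qed auto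
  from tendsto_power[OF this, of 2] show ?thesis by simp
qed

text \<open>The analytic content of the two removal inequalities, for an arbitrary sequence with values in the
unit interval.\<close>
locale removal_inequalities =
  fixes a :: "nat \<Rightarrow> real"
  assumes nonneg: "a n \<ge> 0"
    and le_1: "a n \<le> 1"
    and lower: "(\<Sum>k\<in>{n div 2<..n}. a (n - k) / (real k)\<^sup>2) \<le> a n"
    and upper: "r > 0 \<Longrightarrow> a n \<le> (1 / fact (n div r))\<^sup>2
        + (\<Sum>m\<in>{r<..n}. (1 / real m + 8 / (real m)\<^sup>2)\<^sup>2 * a (n - m))"
begin

definition err :: "nat \<Rightarrow> real" where
  "err n = (real n / fact (n div floor_sqrt n))\<^sup>2"

text \<open>The part of the upper bound for \<open>n\<^sup>2 * a n\<close> that comes from \<open>m = n - j > n/2\<close>; it carries the limit.\<close>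
definition head :: "nat \<Rightarrow> real" where
  "head n = (\<Sum>j<n - n div 2. (real n / real (n - j))\<^sup>2 * (1 + 8 / real (n - j))\<^sup>2 * a j)"

lemma square_weight_le: "m > 0 \<Longrightarrow> (1 / real m + 8 / (real m)\<^sup>2)\<^sup>2 \<le> 81 / (real m)\<^sup>2"
proof -
  assume m: "m > 0"
  then have "8 / (real m)\<^sup>2 \<le> 8 / real m"
    by (intro divide_left_mono) (auto simp: power2_eq_square)
  then have "(1 / real m + 8 / (real m)\<^sup>2)\<^sup>2 \<le> (9 / real m)\<^sup>2"
    by (intro power_mono) auto
  then show ?thesis by (simp add: power_divide)
qed

text \<open>The upper bound at the cutoff \<open>r = floor_sqrt n\<close>, multiplied by \<open>n\<^sup>2\<close>. For \<open>m \<le> n/2\<close> the hypothesis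
applies to \<open>j = n - m \<ge> n/2\<close> and gives \<open>n\<^sup>2 * a j \<le> 4 * C\<close>; the factor \<open>81 / m\<^sup>2\<close> summed over \<open>m > r\<close> is
at most \<open>81 / r\<close>, and \<open>324 = 4 * 81\<close>.\<close>
lemma scaled_upper:
  assumes n: "n > 0" and C: "\<And>j. j < n \<Longrightarrow> (real j)\<^sup>2 * a j \<le> C"
  shows "(real n)\<^sup>2 * a n \<le> err n + 324 * C / floor_sqrt n + head n"
proof -
  define r where "r = floor_sqrt n"
  have r: "r > 0" using n by (simp add: r_def)
  let ?w = "\<lambda>m. (1 / real m + 8 / (real m)\<^sup>2)\<^sup>2"
  have "a n \<le> (1 / fact (n div r))\<^sup>2 + (\<Sum>m\<in>{r<..n}. ?w m * a (n - m))"
    by (rule upper[OF r])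
  also have "(\<Sum>m\<in>{r<..n}. ?w m * a (n - m))
      \<le> (\<Sum>m\<in>{r<..n div 2} \<union> {n div 2<..n}. ?w m * a (n - m))"
    by (rule sum_mono2) (auto intro!: mult_nonneg_nonneg nonneg)
  also have "\<dots> = (\<Sum>m\<in>{r<..n div 2}. ?w m * a (n - m)) + (\<Sum>m\<in>{n div 2<..n}. ?w m * a (n - m))"
    by (rule sum.union_disjoint) auto
  finally have "(real n)\<^sup>2 * a n \<le> (real n)\<^sup>2 * ((1 / fact (n div r))\<^sup>2
      + ((\<Sum>m\<in>{r<..n div 2}. ?w m * a (n - m)) + (\<Sum>m\<in>{n div 2<..n}. ?w m * a (n - m))))"
    by (rule mult_left_mono) auto
  also have "\<dots> = err n + (\<Sum>m\<in>{r<..n div 2}. ?w m * ((real n)\<^sup>2 * a (n - m)))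
      + (\<Sum>m\<in>{n div 2<..n}. (real n)\<^sup>2 * (?w m * a (n - m)))"
    by (simp add: err_def r_def distrib_left sum_distrib_left power_divide mult.left_commute)
  also have "(\<Sum>m\<in>{n div 2<..n}. (real n)\<^sup>2 * (?w m * a (n - m))) = head n"
    unfolding sum_reflect_upper_half head_def
  proof (rule sum.cong[OF refl])
    fix j assume "j \<in> {..<n - n div 2}"
    then have j: "j < n" by auto
    have "real n / x * (1 + 8 / x) = real n * (1 / x + 8 / x\<^sup>2)" for x :: real
      by (cases "x = 0") (simp_all add: field_simps power2_eq_square)
    from this[of "real (n - j)"]
    have "real n / real (n - j) * (1 + 8 / real (n - j)) = real n * (1 / real (n - j) + 8 / (real (n - j))\<^sup>2)" .
    then show "(real n)\<^sup>2 * (?w (n - j) * a (n - (n - j)))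
        = (real n / real (n - j))\<^sup>2 * (1 + 8 / real (n - j))\<^sup>2 * a j"
      using j by (simp only: power_mult_distrib[symmetric] mult.assoc[symmetric]) simp
  qed
  also have "(\<Sum>m\<in>{r<..n div 2}. ?w m * ((real n)\<^sup>2 * a (n - m))) \<le> (\<Sum>m\<in>{r<..n div 2}. 81 / (real m)\<^sup>2 * (4 * C))"
  proof (rule sum_mono)
    fix m assume m: "m \<in> {r<..n div 2}"
    then have "real n \<le> 2 * real (n - m)" by auto
    then have "(real n)\<^sup>2 \<le> (2 * real (n - m))\<^sup>2" by (intro power_mono) auto
    then have "(real n)\<^sup>2 * a (n - m) \<le> (2 * real (n - m))\<^sup>2 * a (n - m)"
      by (intro mult_right_mono nonneg)
    also have "\<dots> = 4 * ((real (n - m))\<^sup>2 * a (n - m))" by (simp add: power_mult_distrib)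
    also have "\<dots> \<le> 4 * C" using m by (intro mult_left_mono C) auto
    finally have "(real n)\<^sup>2 * a (n - m) \<le> 4 * C" .
    note le = this
    have "m > 0" using m by simp
    show "?w m * ((real n)\<^sup>2 * a (n - m)) \<le> 81 / (real m)\<^sup>2 * (4 * C)"
      by (rule mult_mono[OF square_weight_le[OF \<open>m > 0\<close>] le]) (simp_all add: nonneg)
  qed
  also have "\<dots> = 324 * C * (\<Sum>m\<in>{r<..n div 2}. 1 / (real m)\<^sup>2)"
    by (simp add: sum_distrib_left)
  also have "\<dots> \<le> 324 * C * (1 / r)"
  proof (rule mult_left_mono[OF sum_inverse_squares_tail_le[OF r]])
    have "0 \<le> (real 0)\<^sup>2 * a 0" by simp
    also have "\<dots> \<le> C" by (rule C[OF n])
    finally show "0 \<le> 324 * C" by simp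
  qed
  finally show ?thesis by (simp add: r_def)
qed

lemma quotient_le_2: "j < n - n div 2 \<Longrightarrow> real n / real (n - j) \<le> 2"
  by (simp add: field_simps)

lemma head_term_le:
  assumes "j < n - n div 2"
  shows "(real n / real (n - j))\<^sup>2 * (1 + 8 / real (n - j))\<^sup>2 * a j \<le> 324 * a j"
proof -
  have "8 / real (n - j) \<le> 8 / 1" using assms by (intro divide_left_mono) auto
  then have "(1 + 8 / real (n - j))\<^sup>2 \<le> 9\<^sup>2" by (intro power_mono) auto
  moreover have "(real n / real (n - j))\<^sup>2 \<le> 2\<^sup>2"
    using quotient_le_2[OF assms] by (intro power_mono) auto
  ultimately have "(real n / real (n - j))\<^sup>2 * (1 + 8 / real (n - j))\<^sup>2 \<le> 2\<^sup>2 * 9\<^sup>2"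
    by (intro mult_mono) auto
  then show ?thesis by (intro mult_right_mono nonneg) simp
qed

lemma err_tendsto_0: "err \<longlonglongrightarrow> 0"
  using square_div_fact_floor_sqrt_tendsto_0 by (simp add: err_def[abs_def])

text \<open>By strong induction on \<open>n\<close>. In \<open>scaled_upper\<close> the coefficient of \<open>C\<close> is small once \<open>n\<close> is large. The
terms of \<open>head n\<close> with \<open>j \<le> J\<close> are bounded outright, and those with \<open>j > J\<close> sum to at most
\<open>324 * C / J\<close> by the induction hypothesis.\<close>
lemma quadratic_bound: "\<exists>C. \<forall>n. (real n)\<^sup>2 * a n \<le> C"
proof -
  obtain E where E: "\<And>n. err n \<le> E"
    using convergent_imp_Bseq[OF convergentI[OF err_tendsto_0]]
    by (auto simp: Bseq_def abs_le_iff)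
  \<comment> \<open>Chosen so that \<open>324 / J = 1/4\<close>: the two terms proportional to \<open>C\<close> then take up at most half of \<open>C\<close>,
    and the other terms fit into the other half.\<close>
  define J where "J = (1296 :: nat)"
  define C where "C = max (real J ^ 4) (2 * (E + 324 * (real J + 1)))"
  have "(real n)\<^sup>2 * a n \<le> C" for n
  proof (induction n rule: less_induct)
    case (less n)
    show ?case
    proof (cases "n \<le> J\<^sup>2")
      \<comment> \<open>For small \<open>n\<close> the bound \<open>a n \<le> 1\<close> suffices; otherwise \<open>floor_sqrt n \<ge> J\<close>.\<close>
      case True
      then have "real n \<le> (real J)\<^sup>2" by (metis of_nat_le_iff of_nat_power)
      then have "(real n)\<^sup>2 \<le> ((real J)\<^sup>2)\<^sup>2" by (intro power_mono) auto
      then have "(real n)\<^sup>2 * a n \<le> ((real J)\<^sup>2)\<^sup>2 * 1"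
        using le_1 nonneg by (intro mult_mono) auto
      then show ?thesis by (simp add: C_def)
    next
      case False
      then have n: "n > 0" and "J\<^sup>2 \<le> n" by auto
      then have r: "J \<le> floor_sqrt n" by (metis floor_sqrt_inverse_power2 mono_floor_sqrt')
      have C0: "C \<ge> 0" by (simp add: C_def le_max_iff_disj)
      have "head n \<le> (\<Sum>j<n - n div 2. 324 * a j)"
        unfolding head_def by (intro sum_mono head_term_le) auto
      also have "\<dots> \<le> (\<Sum>j\<in>{..J} \<union> {J<..n - 1}. 324 * a j)"
        using n by (intro sum_mono2) (auto intro: nonneg)
      also have "\<dots> = (\<Sum>j\<in>{..J}. 324 * a j) + (\<Sum>j\<in>{J<..n - 1}. 324 * a j)"
        by (intro sum.union_disjoint) auto
      also have "(\<Sum>j\<in>{..J}. 324 * a j) \<le> (\<Sum>j\<in>{..J}. 324)"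
        using le_1 by (intro sum_mono) auto
      also have "(\<Sum>j\<in>{J<..n - 1}. 324 * a j) \<le> (\<Sum>j\<in>{J<..n - 1}. 324 * C * (1 / (real j)\<^sup>2))"
      proof (rule sum_mono)
        fix j assume "j \<in> {J<..n - 1}"
        then have j: "j < n" "j > 0" by auto
        then show "324 * a j \<le> 324 * C * (1 / (real j)\<^sup>2)"
          using less.IH[OF j(1)] by (simp add: field_simps)
      qed
      also have "\<dots> = 324 * C * (\<Sum>j\<in>{J<..n - 1}. 1 / (real j)\<^sup>2)"
        by (simp add: sum_distrib_left)
      also have "\<dots> \<le> 324 * C * (1 / J)"
        using C0 by (intro mult_left_mono sum_inverse_squares_tail_le) (auto simp: J_def)
      finally have head: "head n \<le> 324 * (real J + 1) + C / 4" by (simp add: J_def)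
      have "324 * C / floor_sqrt n \<le> 324 * C / J"
        using r C0 n by (intro divide_left_mono) (auto simp: J_def)
      then have "324 * C / floor_sqrt n \<le> C / 4" by (simp add: J_def)
      moreover have "2 * (E + 324 * (real J + 1)) \<le> C" by (simp add: C_def)
      moreover have "(real n)\<^sup>2 * a n \<le> err n + 324 * C / floor_sqrt n + head n"
        by (rule scaled_upper[OF n less.IH])
      ultimately show ?thesis
        using head E[of n] by argo
    qed
  qed
  then show ?thesis by blast
qed

lemma summable: "summable a"
proof -
  obtain C where C: "\<And>n. (real n)\<^sup>2 * a n \<le> C" using quadratic_bound by blast
  show ?thesis
  proof (rule summable_comparison_test_ev)
    show "\<forall>\<^sub>F n in sequentially. norm (a n) \<le> C * inverse ((real n) ^ 2)"
      using eventually_gt_at_top[of 0]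
      by eventually_elim (use C nonneg in \<open>simp add: field_simps\<close>)
    show "summable (\<lambda>n. C * inverse ((real n) ^ 2))"
      by (intro summable_mult inverse_power_summable) simp
  qed
qed

lemma filterlim_upper_half: "filterlim (\<lambda>n::nat. n - n div 2) at_top sequentially"
  unfolding filterlim_at_top
proof
  fix Z :: nat
  show "\<forall>\<^sub>F n in sequentially. Z \<le> n - n div 2"
    using eventually_ge_at_top[of "2 * Z"] by eventually_elim auto
qed

text \<open>Tannery's theorem: for fixed \<open>j\<close> the \<open>j\<close>-th term tends to \<open>a j\<close>, and all terms are dominated by
\<open>324 * a j\<close>.\<close>
lemma head_tendsto: "head \<longlonglongrightarrow> suminf a"
proof -
  define t where "t = (\<lambda>j n. if j < n - n div 2 
     then (real n / real (n - j))\<^sup>2 * (1 + 8 / real (n - j))\<^sup>2 * a j else 0)"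
  have head: "head n = (\<Sum>j. t j n)" for n
  proof -
    have "(\<Sum>j. t j n) = (\<Sum>j<n - n div 2. t j n)"
      by (rule suminf_finite) (auto simp: t_def)
    then show ?thesis by (simp add: head_def t_def)
  qed
  have "(\<lambda>n. t j n) \<longlonglongrightarrow> a j" for j
  proof (rule Lim_transform_eventually)
    show "\<forall>\<^sub>F n in sequentially. (real n / (real n - real j))\<^sup>2 * (1 + 8 / (real n - real j))\<^sup>2 * a j = t j n"
      using eventually_ge_at_top[of "2 * j + 2"]
      by eventually_elim (auto simp: t_def of_nat_diff)
    have "(\<lambda>n. (real n / (real n - real j))\<^sup>2 * (1 + 8 / (real n - real j))\<^sup>2) \<longlonglongrightarrow> 1"
      by real_asymp
    from tendsto_mult_right[OF this, of "a j"]
    show "(\<lambda>n. (real n / (real n - real j))\<^sup>2 * (1 + 8 / (real n - real j))\<^sup>2 * a j) \<longlonglongrightarrow> a j"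
      by simp
  qed
  moreover have "\<forall>\<^sub>F (j, n) in at_top \<times>\<^sub>F sequentially. norm (t j n) \<le> 324 * a j"
  proof (intro always_eventually allI)
    fix x :: "nat \<times> nat"
    obtain j n where x: "x = (j, n)" by (cases x)
    have "0 \<le> t j n"
      unfolding t_def by (auto intro!: mult_nonneg_nonneg nonneg)
    moreover have "t j n \<le> 324 * a j"
      using head_term_le[of j n] nonneg[of j] by (simp add: t_def)
    ultimately show "case x of (j, n) \<Rightarrow> norm (t j n) \<le> 324 * a j"
      by (simp add: x)
  qed
  moreover have "summable (\<lambda>j. 324 * a j)"
    by (intro summable_mult summable)
  ultimately show ?thesis
    unfolding head[abs_def] using tannerys_theorem[of t a sequentially "\<lambda>j. 324 * a j"] by simp
qed

text \<open>The upper bound tends to \<open>suminf a\<close> by \<open>head_tendsto\<close>. In the lower bound \<open>n\<^sup>2 / k\<^sup>2 \<ge> 1\<close>, which leaves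
a partial sum of the series.\<close>
lemma square_mult_tendsto: "(\<lambda>n. (real n)\<^sup>2 * a n) \<longlonglongrightarrow> suminf a"
proof -
  obtain C where C: "\<And>n. (real n)\<^sup>2 * a n \<le> C" using quadratic_bound by blast
  have mid: "(\<lambda>n. 324 * C / real (floor_sqrt n)) \<longlonglongrightarrow> 0"
    by (intro tendsto_divide_0[OF tendsto_const] filterlim_at_top_imp_at_infinity
        filterlim_compose[OF filterlim_real_sequentially filterlim_floor_sqrt])
  have up: "(\<lambda>n. err n + 324 * C / floor_sqrt n + head n) \<longlonglongrightarrow> suminf a"
    using tendsto_add[OF tendsto_add[OF err_tendsto_0 mid] head_tendsto] by simp
  have low: "(\<lambda>n. \<Sum>j<n - n div 2. a j) \<longlonglongrightarrow> suminf a"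
    by (rule filterlim_compose[OF summable_LIMSEQ[OF summable] filterlim_upper_half])
  show ?thesis
  proof (rule tendsto_sandwich[OF _ _ low up])
    show "\<forall>\<^sub>F n in sequentially. (real n)\<^sup>2 * a n \<le> err n + 324 * C / floor_sqrt n + head n"
      using eventually_gt_at_top[of 0] by eventually_elim (rule scaled_upper[OF _ C])
    show "\<forall>\<^sub>F n in sequentially. (\<Sum>j<n - n div 2. a j) \<le> (real n)\<^sup>2 * a n"
    proof (intro always_eventually allI)
      fix n
      have "(\<Sum>j<n - n div 2. a j) \<le> (\<Sum>j<n - n div 2. (real n)\<^sup>2 * (a (n - (n - j)) / (real (n - j))\<^sup>2))"
      proof (rule sum_mono)
        fix j assume "j \<in> {..<n - n div 2}"
        then have j: "j < n" by auto
        then have "(real (n - j))\<^sup>2 \<le> (real n)\<^sup>2" by (intro power_mono) auto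
        then have "a j * (real (n - j))\<^sup>2 \<le> a j * (real n)\<^sup>2" by (intro mult_left_mono nonneg)
        then show "a j \<le> (real n)\<^sup>2 * (a (n - (n - j)) / (real (n - j))\<^sup>2)"
          using j by (simp add: field_simps)
      qed
      also have "\<dots> = (real n)\<^sup>2 * (\<Sum>k\<in>{n div 2<..n}. a (n - k) / (real k)\<^sup>2)"
        unfolding sum_reflect_upper_half sum_distrib_left ..
      also have "\<dots> \<le> (real n)\<^sup>2 * a n"
        by (intro mult_left_mono lower) simp
      finally show "(\<Sum>j<n - n div 2. a j) \<le> (real n)\<^sup>2 * a n" .
    qed
  qed
qed

end

section \<open>The asymptotic formula\<close>

theorem theorem1p7:
  shows "summable (\<lambda>n. rho (sym_group n))
    \<and> (\<lambda>n. rho (sym_group n)) \<sim>[sequentially] (\<lambda>n. A_rho / (real n)^2)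
    \<and> (\<lambda>n. (real n)^2 * rho (sym_group n)) \<longlonglongrightarrow> A_rho"
proof -
  let ?a = "\<lambda>n. rho (sym_group n)"
  have eq: "?a n = commuting_weight n" for n
    by (simp only: rho_sym_group commuting_weight_def)
  interpret removal_inequalities ?a
  proof
    show "0 \<le> ?a n" and "?a n \<le> 1" for n by (simp_all add: rho_def)
    show "(\<Sum>k\<in>{n div 2<..n}. ?a (n - k) / (real k)\<^sup>2) \<le> ?a n" for n
      unfolding eq by (rule commuting_weight_lower)
    show "?a n \<le> (1 / fact (n div r))\<^sup>2
        + (\<Sum>m\<in>{r<..n}. (1 / real m + 8 / (real m)\<^sup>2)\<^sup>2 * ?a (n - m))" if "r > 0" for r n
      unfolding eq by (rule commuting_weight_upper[OF that])
  qed
  have lim: "(\<lambda>n. (real n)\<^sup>2 * ?a n) \<longlonglongrightarrow> A_rho"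
    using square_mult_tendsto by (simp only: A_rho_def)
  have "commuting_types {#} {#}"
    unfolding commuting_types_def
    by (intro exI[of _ "{}"] exI[of _ id]) (simp add: perm_on_def)
  then have "?a 0 = 1" by (simp add: rho_sym_group)
  moreover have "?a 0 \<le> A_rho"
    using sum_le_suminf[OF summable, of "{0}"] nonneg by (simp add: A_rho_def)
  ultimately have pos: "A_rho > 0" by simp
  have "(\<lambda>n. ?a n / (A_rho / (real n)\<^sup>2)) \<longlonglongrightarrow> 1"
    using tendsto_divide[OF lim tendsto_const[of A_rho]] pos by (simp add: mult.commute)
  then have "?a \<sim>[sequentially] (\<lambda>n. A_rho / (real n)\<^sup>2)"
    by (rule asymp_equivI')
  with summable lim show ?thesis by blast
qed

end
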